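(* Let $K \subset \mathbb{C}$ be a nonempty compact connected set and let $\epsilon > 0$. Then there is a polynomial $p$ whose set of critical values is exactly $\{-1, 1\}$ such that the set $T = p^{-1}([-1,1])$ is within Hausdorff distance $\epsilon$ of $K$.
   Context: A critical value of a polynomial $p$ is a value $p(c)$ with $p'(c) = 0$. The Hausdorff distance between two compact sets $A, B \subset \mathbb{C}$ is the infimum of those $\epsilon > 0$ such that each of the two sets is contained in the $\epsilon$-neighborhood of the other. *)

theory Defs
  imports "HOL-Analysis.Analysis" "HOL-Computational_Algebra.Polynomial"
begin

definition critical_values :: "complex poly \<Rightarrow> complex set" where
  "critical_values p = {poly p c | c. poly (pderiv p) c = 0}"

definition nbhd :: "complex set \<Rightarrow> real \<Rightarrow> complex set" where
  "nbhd A e = {z. \<exists>a\<in>A. dist z a < e}"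

definition hausdorff_dist :: "complex set \<Rightarrow> complex set \<Rightarrow> real" where
  "hausdorff_dist A B = Inf {e. e > 0 \<and> A \<subseteq> nbhd B e \<and> B \<subseteq> nbhd A e}"

end

theory Submission
  imports Defs "HOL-Complex_Analysis.Complex_Analysis"
    "HOL-Computational_Algebra.Fundamental_Theorem_Algebra"
begin

text \<open>
  Thicken \<open>K\<close> slightly to an open set \<open>U\<close> and join the points of a finite net of \<open>K\<close> inside \<open>U\<close> by a
  continuum \<open>T\<close> with connected complement. Polynomials whose zeros are Fejer points of an exterior
  level curve of \<open>T\<close> give, suitably scaled, a polynomial \<open>p\<close> with \<open>|p| < 1\<close> on \<open>T\<close> and at all
  critical points, and with \<open>{|p| \<le> 1} \<subseteq> U\<close>. These properties survive small perturbations, and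
  near a polynomial with distinct critical points the critical values can be prescribed freely. So
  all critical values of a perturbation \<open>q\<close> can be moved to points \<open>v\<close> with
  \<open>h (2 * v ^ n - 1) = \<plusminus>1\<close>, where \<open>h\<close> is a Chebyshev polynomial: for large \<open>n\<close> and large degree
  of \<open>h\<close> these points are dense enough in the unit disk. The composition \<open>h (2 * q ^ n - 1)\<close> then
  has critical values \<open>\<plusminus>1\<close>, and its preimage of \<open>[-1, 1]\<close> is the preimage under \<open>q\<close> of a star of
  \<open>n\<close> radii of the unit disk, which is contained in \<open>U\<close> and passes close to every point of the net.
\<close>

section \<open>Nonseparating continua\<close>

text \<open>Critical values of \<open>h (2 * q ^ n - 1)\<close> have three sources: those of
  \<open>h\<close>, the zeros of \<open>q\<close>, which go to \<open>h (-1)\<close>, and the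
  critical values of \<open>q\<close>. Only the last are an obstacle: they are arbitrary, and a
  small change of the polynomial moves them only a little. So the targets are brought to them:
  points that end in -1 or 1 become dense in the unit disk, which is why all critical values must
  first have modulus below 1. A conformal map of the exterior of a continuum achieves this: in the
  exterior coordinate a Fejer polynomial looks like a pure power, which has no critical points
  outside a level curve. \<open>K\<close> itself cannot serve here, as it may separate the plane,
  fail to be path connected or be a single point. That the final preimage passes close to the net
  cannot rest on the shape of \<open>q\<close>, which is chosen last. It rests on the leading
  coefficient, which the perturbation leaves fixed: a polynomial takes every value near its value at
  \<open>w\<close> at a point near \<open>w\<close>, with a bound that depends only on degree and
  leading coefficient.\<close>

lemma arc_to_closed_set:
  fixes T U :: "'a::{complete_space,real_normed_vector} set"
  assumes "closed T" "path_connected U" "T \<subseteq> U" "x \<in> T" "y \<in> U" "y \<notin> T"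
  obtains \<gamma> where "arc \<gamma>" "path_image \<gamma> \<subseteq> U" "pathstart \<gamma> = y" "path_image \<gamma> \<inter> T = {pathfinish \<gamma>}"
proof -
  obtain g where g: "arc g" "path_image g \<subseteq> U" "pathstart g = y" "pathfinish g = x"
    using assms unfolding path_connected_arcwise by (metis subsetD)
  \<comment> \<open>Stopping at the first point of \<open>T\<close> makes the intersection a single
    point; Janiszewski's theorem, applied to the arc and \<open>T\<close>, asks for a connected
    intersection.\<close>
  obtain u where u: "0 \<le> u" "u \<le> 1" "g u \<in> frontier (- T)"
      "path_image (subpath 0 u g) - {g u} \<subseteq> interior (- T)"
    using subpath_to_frontier[of g "- T"] g assms arc_imp_path closure_subset
    by (metis ComplD ComplI subsetD)
  have guT: "g u \<in> T"
    using u(3) assms(1) by (simp add: frontier_def interior_open open_Compl)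
  have "u \<noteq> 0"
    using guT g(3) \<open>y \<notin> T\<close> by (auto simp: pathstart_def)
  have "arc (subpath 0 u g)"
    using g(1) u \<open>u \<noteq> 0\<close> by (intro arc_subpath_arc) auto
  moreover have "path_image (subpath 0 u g) \<subseteq> U"
    using g(2) path_image_subpath_subset[of 0 u g] u by auto
  moreover have "pathstart (subpath 0 u g) = y"
    using g(3) by (simp add: pathstart_def subpath_def)
  moreover have "path_image (subpath 0 u g) \<inter> T = {pathfinish (subpath 0 u g)}"
  proof -
    have "path_image (subpath 0 u g) \<inter> T \<subseteq> {g u}"
      using u(4) interior_subset[of "- T"] by auto
    moreover have "g u \<in> path_image (subpath 0 u g)"
      by (metis pathfinish_in_path_image pathfinish_subpath)
    ultimately show ?thesis using guT by auto
  qed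
  ultimately show thesis using that by blast
qed

text \<open>The continuum is grown one point of \<open>F\<close> at a time. An arc does not separate
  the plane, so by Janiszewski's theorem attaching one that meets \<open>T\<close> in a single point
  keeps the complement connected.\<close>

lemma nonseparating_continuum_exists:
  fixes U F :: "complex set"
  assumes "open U" "connected U" "finite F" "F \<noteq> {}" "F \<subseteq> U"
  shows "\<exists>T. compact T \<and> path_connected T \<and> connected (- T) \<and> F \<subseteq> T \<and> T \<subseteq> U"
  using assms(3-5)
proof (induction F rule: finite_ne_induct)
  case (singleton x)
  have "connected (- {x::complex})"
    by (rule connected_punctured_universe) simp
  then show ?case using singleton by (intro exI[of _ "{x}"]) auto
next
  case (insert x F)
  then obtain T where T: "compact T" "path_connected T" "connected (- T)" "F \<subseteq> T" "T \<subseteq> U"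
    by auto
  show ?case
  proof (cases "x \<in> T")
    case True
    then show ?thesis using T by auto
  next
    case False
    obtain y where y: "y \<in> T" using T \<open>F \<noteq> {}\<close> by auto
    have "path_connected U"
      using assms by (simp add: connected_open_path_connected)
    then obtain \<gamma> where \<gamma>: "arc \<gamma>" "path_image \<gamma> \<subseteq> U" "pathstart \<gamma> = x"
        "path_image \<gamma> \<inter> T = {pathfinish \<gamma>}"
      using arc_to_closed_set[OF compact_imp_closed[OF T(1)] _ T(5) y, of x] False insert.prems
      by auto
    have "connected (- (path_image \<gamma> \<union> T))"
      using T \<gamma> connected_arc_complement[of \<gamma>]
      by (intro Janiszewski_connected) (auto simp: compact_arc_image compact_imp_closed)
    moreover have "path_connected (path_image \<gamma> \<union> T)"
      using \<gamma> T by (intro path_connected_Un path_connected_path_image arc_imp_path) auto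
    moreover have "x \<in> path_image \<gamma>" using \<gamma>(3) by (metis pathstart_in_path_image)
    ultimately show ?thesis
      using T \<gamma> by (intro exI[of _ "path_image \<gamma> \<union> T"]) (auto simp: compact_arc_image)
  qed
qed

lemma continuum_approximation:
  fixes K :: "complex set"
  assumes "K \<noteq> {}" "compact K" "connected K" "\<epsilon> > 0"
  obtains F T where "finite F" "F \<subseteq> T" "K \<subseteq> (\<Union>x\<in>F. ball x \<epsilon>)" "T \<subseteq> (\<Union>x\<in>K. ball x \<epsilon>)"
    "compact T" "path_connected T" "connected (- T)" "\<exists>a\<in>T. \<exists>b\<in>T. a \<noteq> b"
proof -
  let ?U = "\<Union>x\<in>K. ball x \<epsilon>"
  obtain F where F: "finite F" "F \<subseteq> K" "K \<subseteq> (\<Union>x\<in>F. ball x \<epsilon>)"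
    using compactE_image[OF \<open>compact K\<close>, of K "\<lambda>x. ball x \<epsilon>"] assms(4) by force
  obtain k where k: "k \<in> K" using assms by auto
  have conn: "connected ?U"
  proof -
    \<comment> \<open>Each \<open>K \<union> ball x \<epsilon>\<close> is connected, and all of them
      share \<open>K\<close>.\<close>
    have eq: "?U = \<Union> ((\<lambda>x. K \<union> ball x \<epsilon>) ` K)" using assms by auto
    show ?thesis
      unfolding eq
      by (rule connected_Union) (use assms in \<open>auto intro!: connected_Un\<close>)
  qed
  \<comment> \<open>A second point keeps \<open>T\<close> from being a singleton, also when
    \<open>K\<close> is one; the exterior of a single point would be carried to the whole plane,
    which has no Riemann map.\<close>
  define b where "b = k + of_real (\<epsilon>/2)"
  have "b \<in> ball k \<epsilon>" using assms(4) unfolding b_def by (simp add: dist_norm)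
  then have "b \<in> ?U" using k by blast
  moreover have "K \<subseteq> ?U" using assms by auto
  ultimately obtain T where T: "compact T" "path_connected T" "connected (- T)"
      "insert k (insert b F) \<subseteq> T" "T \<subseteq> ?U"
    using nonseparating_continuum_exists[of ?U "insert k (insert b F)"] F k conn by blast
  have "k \<noteq> b" using assms unfolding b_def by simp
  then show thesis using F T that[of F T] by blast
qed

text \<open>The set is the exterior of \<open>T\<close>, including infinity, seen through z -> 1 /
  (z - a): infinity becomes 0 and \<open>a\<close> becomes infinity. It is simply connected because
  its complement has no bounded component: an arc in \<open>T\<close> from a given point to
  \<open>a\<close> is carried to a curve that runs off to infinity inside the complement.\<close>

lemma simply_connected_inverted_complement:
  fixes T :: "complex set"
  assumes "compact T" "path_connected T" "connected (- T)" "a \<in> T"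
  shows "open (- (\<lambda>z. 1 / (z - a)) ` (T - {a}))"
    and "simply_connected (- (\<lambda>z. 1 / (z - a)) ` (T - {a}))"
proof -
  let ?i = "\<lambda>z. 1 / (z - a)"
  let ?\<Omega> = "- ?i ` (T - {a})"
  obtain R where R: "R > 0" "T \<subseteq> ball a R"
    using bounded_subset_ballD[OF compact_imp_bounded[OF assms(1)]] by metis
  have eq: "?\<Omega> - {0} = ?i ` (- T)"
  proof (intro equalityI subsetI)
    fix w assume w: "w \<in> ?\<Omega> - {0}"
    then have "?i (a + 1/w) = w" by simp
    moreover have "a + 1/w \<notin> T"
    proof
      assume "a + 1/w \<in> T"
      with w have "?i (a + 1/w) \<in> ?i ` (T - {a})" by (intro imageI) auto
      with w show False by simp
    qed
    ultimately show "w \<in> ?i ` (- T)" by (metis ComplI imageI)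
  next
    fix w assume "w \<in> ?i ` (- T)"
    then obtain z where z: "w = ?i z" "z \<notin> T" by auto
    then have "z \<noteq> a" using assms by auto
    moreover have "y = z" if "?i y = ?i z" "y \<noteq> a" for y
      using that \<open>z \<noteq> a\<close> by simp
    ultimately show "w \<in> ?\<Omega> - {0}" using z by auto
  qed
  \<comment> \<open>As \<open>T\<close> is bounded, a whole neighbourhood of infinity lies outside
    it; this makes 0 an interior point.\<close>
  have ball: "ball 0 (1/R) \<subseteq> ?\<Omega>"
  proof -
    have "norm (?i z) \<ge> 1/R" if "z \<in> T - {a}" for z
    proof -
      have "norm (z - a) \<le> R" "norm (z - a) > 0"
        using that R by (auto simp: dist_norm norm_minus_commute intro!: less_imp_le)
      then have "1 / R \<le> 1 / norm (z - a)" by (intro divide_left_mono mult_pos_pos R) auto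
      then show ?thesis by (simp add: norm_divide)
    qed
    then show ?thesis by (force simp del: norm_divide simp: not_less[symmetric])
  qed
  have conn: "connected ?\<Omega>"
  proof -
    have c1: "connected (?\<Omega> - {0})"
      unfolding eq using assms by (intro connected_continuous_image continuous_intros) auto
    have "?\<Omega> \<subseteq> closure (?\<Omega> - {0})"
    proof
      fix w assume w: "w \<in> ?\<Omega>"
      show "w \<in> closure (?\<Omega> - {0})"
      proof (cases "w = 0")
        case False
        with w have "w \<in> ?\<Omega> - {0}" by blast
        then show ?thesis by (rule subsetD[OF closure_subset])
      next
        case True
        have "0 \<in> closure (ball 0 (1/R) - {0::complex})"
          unfolding islimpt_in_closure[symmetric] islimpt_ball using R by simp
        moreover have "closure (ball 0 (1/R) - {0}) \<subseteq> closure (?\<Omega> - {0})"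
          by (intro closure_mono Diff_mono ball order_refl)
        ultimately show ?thesis unfolding True by (rule subsetD[rotated])
      qed
    qed
    then show ?thesis by (rule connected_intermediate_closure[OF c1 Diff_subset])
  qed
  show op: "open ?\<Omega>"
  proof -
    have "open ({w. w \<noteq> 0} \<inter> (\<lambda>w. a + 1/w) -` (- T))"
      using assms by (intro continuous_open_preimage continuous_intros open_Collect_neq) (auto simp: open_Compl compact_imp_closed)
    also have "{w. w \<noteq> 0} \<inter> (\<lambda>w. a + 1/w) -` (- T) = ?\<Omega> - {0}"
    proof (intro equalityI subsetI)
      fix w assume "w \<in> {w. w \<noteq> 0} \<inter> (\<lambda>w. a + 1/w) -` (- T)"
      then have "w = ?i (a + 1/w)" "a + 1/w \<in> - T" by auto
      then show "w \<in> ?\<Omega> - {0}" unfolding eq by (rule image_eqI)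
    next
      fix w assume "w \<in> ?\<Omega> - {0}"
      then obtain z where "z \<in> - T" "w = ?i z" unfolding eq by blast
      moreover from this have "z \<noteq> a" using assms by auto
      ultimately show "w \<in> {w. w \<noteq> 0} \<inter> (\<lambda>w. a + 1/w) -` (- T)" by simp
    qed
    finally have "open ((?\<Omega> - {0}) \<union> ball 0 (1/R))" by blast
    also have "(?\<Omega> - {0}) \<union> ball 0 (1/R) = ?\<Omega>"
    proof -
      have "0 \<in> ball 0 (1/R)" using R by simp
      then show ?thesis using ball by blast
    qed
    finally show ?thesis .
  qed
  have "inside ?\<Omega> = {}"
  proof (rule ccontr)
    assume "inside ?\<Omega> \<noteq> {}"
    then obtain w where w: "w \<in> inside ?\<Omega>" by auto
    then have bd: "bounded (connected_component_set (- ?\<Omega>) w)" and "w \<notin> ?\<Omega>"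
      by (auto simp: inside_def)
    then obtain x where x: "x \<in> T" "x \<noteq> a" "w = ?i x" by auto
    obtain \<gamma> where \<gamma>: "arc \<gamma>" "path_image \<gamma> \<subseteq> T" "pathstart \<gamma> = x" "pathfinish \<gamma> = a"
      using assms x unfolding path_connected_arcwise by metis
    \<comment> \<open>The end point is left out: it is the pole of the inversion.\<close>
    define S where "S = \<gamma> ` {0..<1}"
    have cont: "continuous_on {0..1} \<gamma>" using \<gamma>(1) by (simp add: arc_def path_def)
    have inj: "inj_on \<gamma> {0..1}" using \<gamma>(1) by (simp add: arc_def)
    have S: "S \<subseteq> T - {a}"
    proof -
      have "\<gamma> t \<noteq> a" if "t \<in> {0..<1}" for t
        using that inj \<gamma>(4) unfolding pathfinish_def inj_on_def by force
      then show ?thesis using \<gamma>(2) unfolding S_def path_image_def by force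
    qed
    have "connected (?i ` S)"
      unfolding S_def
      by (intro connected_continuous_image continuous_intros continuous_on_subset[OF cont] convex_connected)
         (use S in \<open>auto simp: S_def\<close>)
    moreover have "w \<in> ?i ` S"
      using x \<gamma>(3) unfolding S_def pathstart_def by force
    ultimately have sub: "?i ` S \<subseteq> connected_component_set (- ?\<Omega>) w"
      using S by (intro connected_component_maximal) auto
    obtain B where B: "B > 0" "\<And>y. y \<in> ?i ` S \<Longrightarrow> norm y \<le> B"
      using bounded_subset[OF bd sub] by (meson bounded_pos)
    have "((\<lambda>t. norm (\<gamma> t - a)) \<longlongrightarrow> norm (\<gamma> 1 - a)) (at 1 within {0..1})"
      using cont by (intro tendsto_intros) (auto simp: continuous_on_def)
    then have "((\<lambda>t. norm (\<gamma> t - a)) \<longlongrightarrow> 0) (at 1 within {0..1})"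
      using \<gamma>(4) by (simp add: pathfinish_def)
    then have "eventually (\<lambda>t. norm (\<gamma> t - a) < 1/B) (at 1 within {0..1})"
      using B by (intro order_tendstoD) auto
    then obtain d where d: "d > 0" "\<And>t. t \<in> {0..1} \<Longrightarrow> t \<noteq> 1 \<Longrightarrow> dist t 1 < d \<Longrightarrow> norm (\<gamma> t - a) < 1/B"
      unfolding eventually_at by blast
    define t where "t = max 0 (1 - d/2)"
    have t: "t \<in> {0..<1}" "dist t 1 < d" using d unfolding t_def by (auto simp: dist_real_def)
    have "norm (\<gamma> t - a) < 1/B" using d t by auto
    moreover have "\<gamma> t \<in> S" using t(1) unfolding S_def by blast
    moreover from this have "\<gamma> t \<noteq> a" using S by blast
    ultimately have "norm (?i (\<gamma> t)) > B" using B by (simp add: norm_divide field_simps)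
    moreover have "norm (?i (\<gamma> t)) \<le> B" using B t unfolding S_def by auto
    ultimately show False by simp
  qed
  then show "simply_connected ?\<Omega>"
    using simply_connected_eq_empty_inside[OF op] conn by simp
qed

section \<open>Fejer polynomials and lemniscates\<close>

definition unit_root :: "nat \<Rightarrow> complex" where
  "unit_root n = cis (2 * pi / real n)"

lemma norm_unit_root [simp]: "norm (unit_root n) = 1"
  by (simp add: unit_root_def)

lemma unit_root_power: "unit_root n ^ k = cis (2 * pi * real k / real n)"
  by (simp add: unit_root_def Complex.DeMoivre mult_ac)

lemma unit_root_power_n [simp]: "n > 0 \<Longrightarrow> unit_root n ^ n = 1"
  by (simp add: unit_root_power)

lemma inj_on_unit_root_power: "inj_on (\<lambda>k. unit_root n ^ k) {..<n}"
proof (cases "n = 0")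
  case False
  then have "bij_betw (\<lambda>k. cis (2 * pi * real k / real n)) {..<n} {z. z ^ n = 1}"
    using Complex.bij_betw_roots_unity[of n] by simp
  then show ?thesis unfolding unit_root_power by (auto simp: bij_betw_def)
qed auto

lemma sum_unit_root_power:
  assumes "0 < m" "m < n"
  shows "(\<Sum>k<n. (unit_root n ^ k) ^ m) = 0"
proof -
  have "unit_root n ^ m \<noteq> 1"
    using inj_onD[OF inj_on_unit_root_power[of n], of m 0] assms by auto
  moreover have "(\<Sum>k<n. (unit_root n ^ k) ^ m) = (\<Sum>k<n. (unit_root n ^ m) ^ k)"
    by (simp add: power_mult[symmetric] mult.commute)
  moreover have "(unit_root n ^ m) ^ n = 1"
    using assms by (metis less_trans mult.commute power_mult power_one unit_root_power_n)
  ultimately show ?thesis by (simp add: geometric_sum)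
qed

text \<open>In \<open>v\<close>, both sides are monic of degree \<open>n\<close> with the same
  \<open>n\<close> distinct roots, so a nonzero difference would have lower degree and too many
  roots.\<close>

lemma prod_unit_root:
  fixes v u :: complex
  assumes "n > 0" "u \<noteq> 0"
  shows "(\<Prod>k<n. v - u * unit_root n ^ k) = v ^ n - u ^ n"
proof -
  let ?p = "\<Prod>k<n. [:- (u * unit_root n ^ k), 1:]"
  let ?q = "monom 1 n - [:u ^ n:]"
  have "degree ?p = n" by (simp add: degree_prod_eq_sum_degree)
  moreover have "lead_coeff ?p = 1" by (subst lead_coeff_prod) simp
  ultimately have degp: "degree ?p = n" "coeff ?p n = 1" by simp_all
  have "?p = ?q"
  proof (rule ccontr)
    assume "?p \<noteq> ?q"
    define D where "D = ?p - ?q"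
    have D0: "D \<noteq> 0" using \<open>?p \<noteq> ?q\<close> by (simp add: D_def)
    have "degree D \<le> n"
      unfolding D_def using degp
      by (intro degree_diff_le) (auto simp: degree_monom_eq intro!: degree_diff_le)
    moreover have "coeff D n = 0"
      unfolding D_def using degp \<open>n > 0\<close> by (auto simp: coeff_pCons split: nat.split)
    ultimately have "degree D < n"
      using D0 \<open>n > 0\<close> by (metis eq_zero_or_degree_less)
    moreover have "n \<le> card {x. poly D x = 0}"
    proof -
      have "inj_on (\<lambda>k. u * unit_root n ^ k) {..<n}"
        using inj_on_unit_root_power[of n] assms by (auto simp: inj_on_def)
      then have "card ((\<lambda>k. u * unit_root n ^ k) ` {..<n}) = n"
        by (simp add: card_image)
      moreover have "(\<lambda>k. u * unit_root n ^ k) ` {..<n} \<subseteq> {x. poly D x = 0}"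
      proof safe
        fix k assume "k < n"
        have "(unit_root n ^ k) ^ n = 1"
          using \<open>n > 0\<close> by (metis mult.commute power_mult power_one unit_root_power_n)
        then show "poly D (u * unit_root n ^ k) = 0"
          using \<open>k < n\<close> unfolding D_def
          by (auto simp: poly_prod poly_monom power_mult_distrib)
      qed
      ultimately show ?thesis
        using poly_roots_finite[OF D0] by (metis card_mono)
    qed
    ultimately show False using card_poly_roots_bound[OF D0] by linarith
  qed
  then have "poly ?p v = poly ?q v" by simp
  then show ?thesis by (simp add: poly_prod poly_monom algebra_simps)
qed

text \<open>Averaging over \<open>n\<close> equally spaced points annihilates the powers 1, ..., n -
  1 of the Taylor series. The error comes from the tail alone, where Cauchy's estimate on the larger
  circle of radius \<open>t\<close> gives geometric decay in \<open>n\<close>.\<close>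

lemma holomorphic_unit_root_average:
  assumes J: "J holomorphic_on ball 0 1" and bound: "\<And>u. norm u = t \<Longrightarrow> norm (J u) \<le> M"
    and "0 < s" "s < t" "t < 1" "n > 0"
  shows "norm ((\<Sum>k<n. J (of_real s * unit_root n ^ k)) - of_nat n * J 0)
           \<le> real n * (M * (s / t) ^ n / (1 - s / t))"
proof -
  define a where "a m = (deriv ^^ m) J 0 / fact m" for m
  define \<tau> where "\<tau> = s / t"
  have \<tau>: "0 < \<tau>" "\<tau> < 1" using assms by (auto simp: \<tau>_def)
  have a: "norm (a m) \<le> M / t ^ m" for m
  proof -
    have "norm ((deriv ^^ m) J 0) \<le> fact m * M / t ^ m"
      using assms by (intro Cauchy_inequality)
        (auto intro!: holomorphic_on_imp_continuous_on holomorphic_on_subset[OF J])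
    then show ?thesis by (simp add: a_def norm_divide field_simps)
  qed
  have M: "M \<ge> 0" using order_trans[OF norm_ge_zero bound[of "of_real t"]] assms by simp
  have tail: "norm (J u - (\<Sum>m<n. a m * u ^ m)) \<le> M * \<tau> ^ n / (1 - \<tau>)" if "norm u = s" for u
  proof -
    have sums: "(\<lambda>m. a m * u ^ m) sums J u"
      using holomorphic_power_series[OF J, of u] that assms by (simp add: a_def)
    then have "J u - (\<Sum>m<n. a m * u ^ m) = (\<Sum>m. a (m + n) * u ^ (m + n))"
      using suminf_split_initial_segment[of "\<lambda>m. a m * u ^ m" n] sums_summable sums_unique by fastforce
    moreover have "norm (\<Sum>m. a (m + n) * u ^ (m + n)) \<le> (\<Sum>m. M * \<tau> ^ n * \<tau> ^ m)"
    proof (rule norm_suminf_le)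
      show "norm (a (m + n) * u ^ (m + n)) \<le> M * \<tau> ^ n * \<tau> ^ m" for m
      proof -
        have "norm (a (m + n) * u ^ (m + n)) \<le> M / t ^ (m + n) * s ^ (m + n)"
          unfolding norm_mult norm_power that using a assms by (intro mult_right_mono) auto
        also have "\<dots> = M * \<tau> ^ n * \<tau> ^ m"
          by (simp add: \<tau>_def power_divide power_add mult_ac)
        finally show ?thesis .
      qed
      show "summable (\<lambda>m. M * \<tau> ^ n * \<tau> ^ m)"
        using \<tau> by (intro summable_mult summable_geometric) auto
    qed
    moreover have "(\<Sum>m. M * \<tau> ^ n * \<tau> ^ m) = M * \<tau> ^ n / (1 - \<tau>)"
      using \<tau> by (subst suminf_mult) (auto simp: suminf_geometric summable_geometric)
    ultimately show ?thesis by simp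
  qed
  define u where "u k = of_real s * unit_root n ^ k" for k
  have nu: "norm (u k) = s" for k using assms by (simp add: u_def norm_mult norm_power)
  have "(\<Sum>k<n. \<Sum>m<n. a m * u k ^ m) = (\<Sum>m<n. a m * of_real s ^ m * (\<Sum>k<n. (unit_root n ^ k) ^ m))"
    by (subst sum.swap) (simp add: u_def power_mult_distrib sum_distrib_left mult_ac)
  also have "\<dots> = (\<Sum>m<n. if m = 0 then a 0 * of_nat n else 0)"
    by (intro sum.cong) (auto simp: sum_unit_root_power)
  also have "\<dots> = of_nat n * J 0" using \<open>n > 0\<close> by (simp add: a_def)
  finally have "(\<Sum>k<n. J (u k)) - of_nat n * J 0 = (\<Sum>k<n. J (u k) - (\<Sum>m<n. a m * u k ^ m))"
    by (simp add: sum_subtractf)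
  also have "norm \<dots> \<le> (\<Sum>k<n. M * \<tau> ^ n / (1 - \<tau>))"
    using tail nu by (intro sum_norm_le) auto
  also have "\<dots> = real n * (M * \<tau> ^ n / (1 - \<tau>))" by simp
  finally show ?thesis by (simp add: u_def \<tau>_def)
qed

section \<open>Logarithmic derivatives and Fejer polynomials\<close>

lemma log_derivative_mult:
  fixes f g :: "'a::real_normed_field \<Rightarrow> 'a"
  assumes "(f has_field_derivative f x * l) (at x)" "(g has_field_derivative g x * m) (at x)"
  shows "((\<lambda>x. f x * g x) has_field_derivative f x * g x * (l + m)) (at x)"
  by (rule DERIV_cong[OF DERIV_mult[OF assms]]) (simp add: algebra_simps)

text \<open>Derivatives are kept in the form \<open>h k x * l k\<close>, so that logarithmic
  derivatives add up along a product without division by a factor.\<close>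

lemma has_field_derivative_prod_log:
  fixes h :: "'i \<Rightarrow> 'a::real_normed_field \<Rightarrow> 'a"
  assumes "finite A" "\<And>k. k \<in> A \<Longrightarrow> (h k has_field_derivative h k x * l k) (at x)"
  shows "((\<lambda>x. \<Prod>k\<in>A. h k x) has_field_derivative (\<Prod>k\<in>A. h k x) * (\<Sum>k\<in>A. l k)) (at x)"
  using assms
proof (induction A rule: finite_induct)
  case (insert k A)
  then have "((\<lambda>x. h k x * (\<Prod>k\<in>A. h k x)) has_field_derivative
      h k x * (\<Prod>k\<in>A. h k x) * (l k + (\<Sum>k\<in>A. l k))) (at x)"
    by (intro log_derivative_mult) auto
  then show ?case using insert by simp
qed auto

text \<open>The expression is the derivative in \<open>v\<close> of log ((g u - g v) / (u - v)). Its
  singularity at \<open>u = v\<close> cancels, and injectivity keeps the difference quotient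
  \<open>D\<close> from vanishing, also on the diagonal.\<close>

lemma log_difference_kernel:
  assumes g: "g holomorphic_on ball 0 1" "inj_on g (ball 0 1)" and v: "v \<in> ball 0 1"
  shows "\<exists>J. J holomorphic_on ball 0 1 \<and>
           (\<forall>u\<in>ball 0 1 - {v}. J u = 1 / (u - v) - deriv g v / (g u - g v))"
proof -
  define D where "D u = (if u = v then deriv g v else (g u - g v) / (u - v))" for u
  have D: "D holomorphic_on ball 0 1"
    unfolding D_def by (intro pole_lemma_open g) auto
  have D0: "D u \<noteq> 0" if "u \<in> ball 0 1" for u
    using holomorphic_injective_imp_regular[OF g(1) _ g(2), of v] inj_onD[OF g(2), of u v] that v
    by (auto simp: D_def)
  define J where "J u = (if u = v then deriv D v else (D u - D v) / (u - v)) / D u" for u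
  have "J holomorphic_on ball 0 1"
    unfolding J_def by (intro holomorphic_intros pole_lemma_open D D0) auto
  moreover have "J u = 1 / (u - v) - deriv g v / (g u - g v)" if "u \<in> ball 0 1 - {v}" for u
  proof -
    have "u - v \<noteq> 0" "g u - g v \<noteq> 0" using that v inj_onD[OF g(2), of u v] by auto
    then show ?thesis using that by (simp add: J_def D_def divide_simps)
  qed
  ultimately show ?thesis by blast
qed

text \<open>The bound has to be uniform in \<open>v\<close>, because one \<open>n\<close> must serve
  the whole disk of radius \<rho>; compactness gives it, as \<open>norm u = t\<close> stays off the
  diagonal.\<close>

lemma log_difference_kernel_bounded:
  assumes g: "g holomorphic_on ball 0 1" "inj_on g (ball 0 1)" and "0 \<le> \<rho>" "\<rho> < t" "t < 1"
  obtains M where "\<And>u v. norm u = t \<Longrightarrow> norm v \<le> \<rho> \<Longrightarrow>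
      norm (1 / (u - v) - deriv g v / (g u - g v)) \<le> M"
proof -
  let ?S = "sphere 0 t \<times> cball (0::complex) \<rho>"
  let ?f = "\<lambda>x. 1 / (fst x - snd x) - deriv g (snd x) / (g (fst x) - g (snd x))"
  have c: "continuous_on ?S (\<lambda>x. g (fst x))" "continuous_on ?S (\<lambda>x. g (snd x))"
      "continuous_on ?S (\<lambda>x. deriv g (snd x))"
    using assms
  proof -
    have 1: "continuous_on (ball 0 1) g" "continuous_on (ball 0 1) (deriv g)"
      by (intro holomorphic_on_imp_continuous_on holomorphic_deriv g open_ball)+
    have 2: "fst ` ?S \<subseteq> ball 0 1" "snd ` ?S \<subseteq> ball 0 1" using assms by auto
    show "continuous_on ?S (\<lambda>x. g (fst x))"
      by (rule continuous_on_compose2[OF 1(1) continuous_on_fst 2(1)]) (rule continuous_on_id)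
    show "continuous_on ?S (\<lambda>x. g (snd x))"
      by (rule continuous_on_compose2[OF 1(1) continuous_on_snd 2(2)]) (rule continuous_on_id)
    show "continuous_on ?S (\<lambda>x. deriv g (snd x))"
      by (rule continuous_on_compose2[OF 1(2) continuous_on_snd 2(2)]) (rule continuous_on_id)
  qed
  have ne: "fst x - snd x \<noteq> 0" "g (fst x) - g (snd x) \<noteq> 0" if "x \<in> ?S" for x
    using that assms inj_onD[OF g(2), of "fst x" "snd x"] by auto
  have "continuous_on ?S ?f" using ne by (intro continuous_intros c) auto
  then have "bounded (?f ` ?S)"
    by (intro compact_imp_bounded compact_continuous_image compact_Times) auto
  then obtain M where M: "\<And>y. y \<in> ?f ` ?S \<Longrightarrow> norm y \<le> M"
    unfolding bounded_iff by blast
  show thesis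
  proof (rule that)
    fix u v :: complex assume "norm u = t" "norm v \<le> \<rho>"
    then have "?f (u, v) \<in> ?f ` ?S" by (intro imageI) auto
    then show "norm (1 / (u - v) - deriv g v / (g u - g v)) \<le> M" using M by fastforce
  qed
qed

text \<open>\<open>E\<close> solves \<open>E' = l E\<close> with \<open>|l| \<le> e\<close>; no logarithm of \<open>E\<close> is needed.\<close>

lemma small_log_derivative_imp_near_1:
  assumes E: "E holomorphic_on ball 0 s" and "0 \<le> \<rho>" "\<rho> < s" "s \<le> 1" "E 0 = 1" "e \<le> 1/2"
    and bound: "\<And>v. norm v \<le> \<rho> \<Longrightarrow> norm (deriv E v) \<le> e * norm (E v)"
    and "norm v \<le> \<rho>"
  shows "norm (E v - 1) \<le> 2 * e"
proof -
  have "0 \<le> e"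
    using bound[of 0] order_trans[OF norm_ge_zero bound[of 0]] assms by simp
  \<comment> \<open>Gronwall in one step: at a point \<open>w\<close> where the norm is largest, the
    mean value bound gives norm (E w) <= 1 + e * norm (E w), hence norm (E w) <= 2 since e <=
    1/2.\<close>
  have "continuous_on (cball 0 \<rho>) (\<lambda>v. norm (E v))"
    using assms by (intro continuous_intros holomorphic_on_imp_continuous_on
        holomorphic_on_subset[OF E]) auto
  then obtain w where w: "w \<in> cball 0 \<rho>" "\<And>v. v \<in> cball 0 \<rho> \<Longrightarrow> norm (E v) \<le> norm (E w)"
    using continuous_attains_sup[of "cball 0 \<rho>" "\<lambda>v. norm (E v)"] assms by auto
  have diff: "norm (E x - 1) \<le> e * norm (E w)" if "norm x \<le> \<rho>" for x
  proof -
    have "norm (E x - E 0) \<le> e * norm (E w) * norm (x - 0)"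
    proof (rule field_differentiable_bound[of "cball 0 \<rho>"])
      fix y assume y: "y \<in> cball (0::complex) \<rho>"
      show "(E has_field_derivative deriv E y) (at y within cball 0 \<rho>)"
        using y assms by (intro has_field_derivative_at_within[OF holomorphic_derivI[OF E open_ball]]) simp
      show "norm (deriv E y) \<le> e * norm (E w)"
        using order_trans[OF bound[of y] mult_left_mono[OF w(2)[of y] \<open>0 \<le> e\<close>]] y by simp
    qed (use that assms in auto)
    also have "\<dots> \<le> e * norm (E w) * 1"
      using that assms \<open>0 \<le> e\<close> by (intro mult_left_mono) auto
    finally show ?thesis using assms by simp
  qed
  have "norm (E w) \<le> 1 + e * norm (E w)"
    using diff[of w] w norm_triangle_ineq[of "E w - 1" 1] by simp
  moreover have "e * norm (E w) \<le> 1/2 * norm (E w)"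
    using assms by (intro mult_right_mono) auto
  ultimately have "norm (E w) \<le> 2" by simp
  then have "e * norm (E w) \<le> e * 2" using \<open>0 \<le> e\<close> by (intro mult_left_mono)
  then show ?thesis using diff[of v] assms by simp
qed

text \<open>The zeros of \<open>q\<close> are the values of 1 / g at \<open>n\<close> equally spaced
  points of the circle of radius \<open>s\<close>. Splitting (v - u k) / v off each factor yields
  the main term \<open>1 - (of_real s / v) ^ n\<close>. The logarithmic derivative of the rest,
  \<open>E\<close>, is the sum of \<open>J (u k) - J 0\<close> over the nodes, which the averaging
  estimate bounds by \<open>e\<close>.\<close>

lemma fejer_polynomial:
  assumes g: "g holomorphic_on ball 0 1" "inj_on g (ball 0 1)" "g 0 = 0"
    and "0 < \<rho>" "\<rho> < s" "s < t" "t < 1" "n > 0"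
    and M: "\<And>u v. norm u = t \<Longrightarrow> norm v \<le> \<rho> \<Longrightarrow> norm (1 / (u - v) - deriv g v / (g u - g v)) \<le> M"
  defines "e \<equiv> real n * (M * (s / t) ^ n / (1 - s / t))"
  shows "\<exists>q E. (\<forall>v\<in>cball 0 \<rho> - {0}. poly q (1 / g v) = (1 - (of_real s / v) ^ n) * E v) \<and>
           E holomorphic_on ball 0 s \<and> E 0 = 1 \<and>
           (\<forall>v\<in>cball 0 \<rho>. norm (deriv E v) \<le> e * norm (E v))"
proof -
  define u where "u k = of_real s * unit_root n ^ k" for k
  have nu: "norm (u k) = s" for k using assms by (simp add: u_def norm_mult norm_power)
  have u1: "u k \<in> ball 0 1" "u k \<noteq> 0" for k
    using nu[of k] assms by auto
  have gu: "g (u k) \<noteq> 0" for k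
    using inj_onD[OF g(2), of "u k" 0] u1 g(3) by auto
  define D where "D v = (if v = 0 then deriv g 0 else (g v - g 0) / (v - 0))" for v
  have D: "D holomorphic_on ball 0 1"
    unfolding D_def by (intro pole_lemma_open g) auto
  have D0: "D v \<noteq> 0" if "v \<in> ball 0 1" for v
    using holomorphic_injective_imp_regular[OF g(1) _ g(2), of 0] inj_onD[OF g(2), of v 0] that g(3)
    by (auto simp: D_def)
  \<comment> \<open>\<open>h k v\<close> equals v * (1 / g v - 1 / g (u k)) / (v - u k), the
    \<open>k\<close>-th factor of \<open>q\<close> freed of its zero and of its pole at 0;
    \<open>D v\<close>, that is g v / v, gives it a value at 0.\<close>
  define h where "h k v = (1 / D v) * (1 - g v / g (u k)) / (v - u k)" for k v
  have ne: "v - u k \<noteq> 0" "g v \<noteq> g (u k)" if "v \<in> ball 0 s" for v k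
    using that nu[of k] inj_onD[OF g(2), of "u k" v] u1[of k] assms by auto
  have h: "h k holomorphic_on ball 0 s" for k
    unfolding h_def using ne D0 assms gu
    by (intro holomorphic_intros holomorphic_on_subset[OF D] holomorphic_on_subset[OF g(1)]) auto
  have h0: "h k v \<noteq> 0" if "v \<in> ball 0 s" for v k
    using ne[OF that, of k] D0[of v] that assms gu[of k] by (auto simp: h_def)
  define c where "c = (\<Prod>k<n. h k 0)"
  have c: "c \<noteq> 0" unfolding c_def using h0 assms by auto
  define E where "E v = (\<Prod>k<n. h k v) / c" for v
  have E: "E holomorphic_on ball 0 s"
    unfolding E_def using c by (intro holomorphic_intros h) auto
  have E0: "E 0 = 1" using c by (simp add: E_def c_def)
  define q where "q = smult (1 / c) (\<Prod>k<n. [:- 1 / g (u k), 1:])"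
  have q: "poly q (1 / g v) = (1 - (of_real s / v) ^ n) * E v" if v: "v \<in> cball 0 \<rho> - {0}" for v
  proof -
    have vb: "v \<in> ball 0 s" "v \<noteq> 0" "g v \<noteq> 0"
      using v assms inj_onD[OF g(2), of v 0] by auto
    have *: "1 / g v - 1 / g (u k) = (v - u k) / v * h k v" for k
      using vb ne[OF vb(1), of k] gu[of k] g(3) by (simp add: h_def D_def divide_simps)
    have "poly q (1 / g v) = (\<Prod>k<n. 1 / g v - 1 / g (u k)) / c"
      by (simp add: q_def poly_prod)
    also have "\<dots> = (\<Prod>k<n. v - u k) / v ^ n * (\<Prod>k<n. h k v) / c"
      unfolding * by (simp add: prod.distrib prod_dividef)
    also have "(\<Prod>k<n. v - u k) = v ^ n - of_real s ^ n"
      unfolding u_def using assms by (intro prod_unit_root) auto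
    finally show ?thesis using vb by (simp add: E_def field_simps)
  qed
  have bound: "norm (deriv E v) \<le> e * norm (E v)" if v: "v \<in> ball 0 s - {0}" "norm v \<le> \<rho>" for v
  proof -
    have vb: "v \<in> ball 0 1" "v \<noteq> 0" "g v \<noteq> 0"
      using v assms inj_onD[OF g(2), of v 0] by auto
    obtain J where J: "J holomorphic_on ball 0 1"
        "\<And>u. u \<in> ball 0 1 - {v} \<Longrightarrow> J u = 1 / (u - v) - deriv g v / (g u - g v)"
      using log_difference_kernel[OF g(1,2) vb(1)] by blast
    have "(h k has_field_derivative h k v * (J (u k) - J 0)) (at v)" for k
    proof -
      have dg: "(g has_field_derivative deriv g v) (at v)"
        using vb by (intro holomorphic_derivI[OF g(1)]) auto
      have nek: "v - u k \<noteq> 0" "g v \<noteq> g (u k)" using ne v by auto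
      have J1: "J (u k) = 1 / (u k - v) - deriv g v / (g (u k) - g v)"
        using u1[of k] nek by (intro J(2)) auto
      \<comment> \<open>The factor v / g v present in every \<open>h k\<close> contributes the value
        of \<open>J\<close> at 0; this turns the sum over the nodes into an error of
        averaging.\<close>
      have J2: "J 0 = - 1 / v + deriv g v / g v"
        using vb g(3) J(2)[of 0] by simp
      have "((\<lambda>v. v / g v) has_field_derivative (v / g v) * (1 / v - deriv g v / g v)) (at v)"
        by (rule derivative_eq_intros dg refl vb)+ (use vb in \<open>simp add: field_simps\<close>)
      moreover have "((\<lambda>v. 1 - g v / g (u k)) has_field_derivative
          (1 - g v / g (u k)) * (- deriv g v / (g (u k) - g v))) (at v)"
        by (rule derivative_eq_intros dg refl gu)+ (use nek gu[of k] in \<open>simp add: divide_simps\<close>)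
      moreover have "((\<lambda>v. 1 / (v - u k)) has_field_derivative (1 / (v - u k)) * (1 / (u k - v))) (at v)"
        by (rule derivative_eq_intros refl nek)+ (use nek in \<open>simp add: divide_simps\<close>)
      ultimately have "((\<lambda>v. (v / g v) * (1 - g v / g (u k)) * (1 / (v - u k))) has_field_derivative
          (v / g v) * (1 - g v / g (u k)) * (1 / (v - u k)) * ((1 / v - deriv g v / g v)
             + (- deriv g v / (g (u k) - g v)) + 1 / (u k - v))) (at v)"
        by (intro log_derivative_mult)
      also have "(1 / v - deriv g v / g v) + (- deriv g v / (g (u k) - g v)) + 1 / (u k - v) = J (u k) - J 0"
        by (simp add: J1 J2)
      finally have "((\<lambda>v. (v / g v) * (1 - g v / g (u k)) / (v - u k)) has_field_derivative
          h k v * (J (u k) - J 0)) (at v)"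
        using vb g(3) by (simp add: h_def D_def)
      then show ?thesis
        by (rule has_field_derivative_transform_within_open[of _ _ _ "- {0}"])
           (use vb g(3) in \<open>auto simp: h_def D_def\<close>)
    qed
    then have "((\<lambda>v. \<Prod>k<n. h k v) has_field_derivative (\<Prod>k<n. h k v) * (\<Sum>k<n. J (u k) - J 0)) (at v)"
      by (intro has_field_derivative_prod_log) auto
    then have "(E has_field_derivative (\<Prod>k<n. h k v) * (\<Sum>k<n. J (u k) - J 0) / c) (at v)"
      unfolding E_def by (rule DERIV_cdivide)
    then have "deriv E v = E v * (\<Sum>k<n. J (u k) - J 0)"
      by (simp add: DERIV_imp_deriv E_def)
    moreover have "norm (\<Sum>k<n. J (u k) - J 0) \<le> e"
    proof -
      have "norm (J x) \<le> M" if "norm x = t" for x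
      proof -
        have "x \<in> ball 0 1 - {v}" using that v assms by auto
        then show ?thesis using M[of x v] v that by (simp add: J(2))
      qed
      then have "norm ((\<Sum>k<n. J (u k)) - of_nat n * J 0) \<le> e"
        unfolding u_def e_def using assms by (intro holomorphic_unit_root_average J) auto
      then show ?thesis by (simp add: sum_subtractf)
    qed
    ultimately show ?thesis by (simp add: norm_mult mult.commute[of e] mult_left_mono)
  qed
  have "norm (deriv E v) \<le> e * norm (E v)" if "v \<in> cball 0 \<rho>" for v
  proof (cases "v = 0")
    case False
    then show ?thesis using that bound assms by auto
  next
    \<comment> \<open>At 0 the computation above would divide by \<open>v\<close>; the inequality is
      extended by continuity.\<close>
    case True
    have "continuous_on (ball 0 s) (deriv E)" "continuous_on (ball 0 s) E"
      by (intro holomorphic_on_imp_continuous_on holomorphic_deriv E open_ball)+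
    then have "isCont (deriv E) 0" "isCont E 0"
      using assms by (auto simp: continuous_on_eq_continuous_at)
    have "eventually (\<lambda>v. v \<in> ball 0 \<rho> - {0}) (at (0::complex))"
      using assms by (intro eventually_at_in_open) auto
    then have ev: "eventually (\<lambda>v. norm (deriv E v) \<le> e * norm (E v)) (at 0)"
      by eventually_elim (use bound assms in auto)
    with \<open>isCont (deriv E) 0\<close> \<open>isCont E 0\<close> have "norm (deriv E 0) \<le> e * norm (E 0)"
      by (intro tendsto_le[OF _ _ _ ev] tendsto_intros) (auto simp: isCont_def)
    then show ?thesis using True by simp
  qed
  then show ?thesis using q E E0 by blast
qed

section \<open>Exterior conformal maps and lemniscates\<close>

lemma normalized_Riemann_map:
  assumes "open \<Omega>" "simply_connected \<Omega>" "0 \<in> \<Omega>" "\<Omega> \<noteq> UNIV"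
  obtains f g where "f holomorphic_on \<Omega>" "g holomorphic_on ball 0 1" "g 0 = 0" "inj_on g (ball 0 1)"
    "\<And>z. z \<in> \<Omega> \<Longrightarrow> f z \<in> ball 0 1 \<and> g (f z) = z" "\<And>v. v \<in> ball 0 1 \<Longrightarrow> g v \<in> \<Omega>"
proof -
  obtain f g where f: "f holomorphic_on \<Omega>" "g holomorphic_on ball 0 1"
      "\<And>z. z \<in> \<Omega> \<Longrightarrow> f z \<in> ball 0 1 \<and> g (f z) = z"
      "\<And>v. v \<in> ball 0 1 \<Longrightarrow> g v \<in> \<Omega> \<and> f (g v) = v"
  proof -
    have "\<exists>f g. f holomorphic_on \<Omega> \<and> g holomorphic_on ball 0 1 \<and>
        (\<forall>z\<in>\<Omega>. f z \<in> ball 0 1 \<and> g (f z) = z) \<and> (\<forall>z\<in>ball 0 1. g z \<in> \<Omega> \<and> f (g z) = z)"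
      using Riemann_mapping_theorem[of \<Omega>] assms by (simp del: mem_ball_0 mem_ball) auto
    then show thesis using that by blast
  qed
  \<comment> \<open>A disk automorphism moves \<open>f 0\<close> to the centre, so that the centre
    of the disk stands for infinity outside the continuum.\<close>
  obtain m m' where m: "m (f 0) = 0" "m holomorphic_on ball 0 1" "m ` ball 0 1 \<subseteq> ball 0 1"
      "m' holomorphic_on ball 0 1" "m' ` ball 0 1 \<subseteq> ball 0 1"
      "\<And>z. z \<in> ball 0 1 \<Longrightarrow> m (m' z) = z" "\<And>z. z \<in> ball 0 1 \<Longrightarrow> m' (m z) = z"
    using ball_biholomorphism_exists[of "f 0"] f(3)[of 0] assms by metis
  show thesis
  proof (rule that[of "m \<circ> f" "g \<circ> m'"])
    show "m \<circ> f holomorphic_on \<Omega>"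
      using f(1,3) by (intro holomorphic_on_compose holomorphic_on_subset[OF m(2)]) auto
    show "g \<circ> m' holomorphic_on ball 0 1"
      using m by (intro holomorphic_on_compose holomorphic_on_subset[OF f(2)]) auto
    have "m' 0 = f 0" using m(7)[of "f 0"] m(1) f(3)[OF assms(3)] by simp
    then show "(g \<circ> m') 0 = 0" using f(3)[OF assms(3)] by simp
    show "inj_on (g \<circ> m') (ball 0 1)"
    proof (rule inj_on_inverseI[of _ "m \<circ> f"])
      fix v :: complex assume v: "v \<in> ball 0 1"
      then have "m' v \<in> ball 0 1" using m(5) by blast
      then show "(m \<circ> f) ((g \<circ> m') v) = v" using f(4) m(6)[OF v] by simp
    qed
    show "(m \<circ> f) z \<in> ball 0 1 \<and> (g \<circ> m') ((m \<circ> f) z) = z" if "z \<in> \<Omega>" for z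
    proof -
      have "f z \<in> ball 0 1" "g (f z) = z" using f(3)[OF that] by auto
      moreover from this have "m (f z) \<in> ball 0 1" using m(3) by blast
      ultimately show ?thesis using m(7)[of "f z"] by simp
    qed
    show "(g \<circ> m') v \<in> \<Omega>" if "v \<in> ball 0 1" for v
    proof -
      have "m' v \<in> ball 0 1" using m(5) that by blast
      then show ?thesis using f(4) by simp
    qed
  qed
qed

text \<open>Solutions of \<open>(z - a) * g v = 1\<close> encode the conformal map \<open>v \<mapsto> a + 1 / g v\<close> onto the
  exterior of a continuum containing \<open>a\<close>; the equation excludes \<open>v = 0\<close> and \<open>z = a\<close>.\<close>

lemma mult_diff_eq_1_iff:
  fixes z a w :: "'a::field"
  shows "(z - a) * w = 1 \<longleftrightarrow> z \<noteq> a \<and> w = 1 / (z - a)"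
proof (cases "z = a")
  case False
  then have "z - a \<noteq> 0" by simp
  then show ?thesis using False by (metis mult.commute nonzero_eq_divide_eq)
qed simp

text \<open>\<open>W\<close> is the region outside the level curve of radius \<rho>. Its complement
  is bounded, and by compactness of the closed disk every frontier point comes from some
  \<open>l\<close> of modulus exactly \<rho>; so the maximum principle applies without a description
  of the curve itself.\<close>

lemma polynomial_max_modulus_inside:
  assumes g: "g holomorphic_on ball 0 1" "inj_on g (ball 0 1)" "g 0 = 0" and "0 < \<rho>" "\<rho> < 1"
    and bound: "\<And>z v. norm v = \<rho> \<Longrightarrow> (z - a) * g v = 1 \<Longrightarrow> norm (poly p z) \<le> B"
    and z: "\<not> (\<exists>v\<in>ball 0 \<rho>. (z - a) * g v = 1)"
  shows "norm (poly p z) \<le> B"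
proof -
  define W where "W = {z. \<exists>v\<in>ball 0 \<rho>. (z - a) * g v = 1}"
  have sub: "ball 0 \<rho> \<subseteq> ball (0::complex) 1" using assms by auto
  have opg: "open (g ` ball 0 \<rho>)"
    using g sub by (intro open_mapping_thm3 open_ball)
      (auto intro: holomorphic_on_subset inj_on_subset)
  have W: "W = {z. z \<noteq> a} \<inter> (\<lambda>z. 1 / (z - a)) -` (g ` ball 0 \<rho>)"
    unfolding W_def mult_diff_eq_1_iff by (auto simp del: mem_ball mem_ball_0) (metis image_eqI)
  have "open W"
    unfolding W using opg by (intro continuous_open_preimage continuous_intros open_Collect_neq) auto
  have bdd: "bounded (- W)"
  proof -
    have "0 \<in> g ` ball 0 \<rho>" using g(3) assms by (intro image_eqI[of _ _ 0]) auto
    then obtain d where d: "d > 0" "ball 0 d \<subseteq> g ` ball 0 \<rho>"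
      using opg open_contains_ball by blast
    have "norm (z - a) \<le> 1 / d" if "z \<in> - W" for z
    proof (rule ccontr)
      assume *: "\<not> norm (z - a) \<le> 1 / d"
      then have "norm (z - a) > 0" using d by (smt (verit) divide_pos_pos)
      then have "1 / (z - a) \<in> ball 0 d" using * d by (simp add: norm_divide field_simps)
      then have "z \<in> W" unfolding W using d * by auto
      then show False using that by simp
    qed
    then have "- W \<subseteq> cball a (1 / d)" by (auto simp: dist_norm norm_minus_commute)
    then show ?thesis using bounded_subset bounded_cball by blast
  qed
  have fr: "norm (poly p w) \<le> B" if w: "w \<in> frontier (- W)" for w
  proof -
    have "w \<in> closure W" "w \<notin> W"
      using w \<open>open W\<close> unfolding frontier_complement by (auto simp: frontier_def interior_open)
    then obtain x where x: "\<And>n. x n \<in> W" "x \<longlonglongrightarrow> w"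
      unfolding closure_sequential by blast
    then have "\<forall>n. \<exists>v. v \<in> ball 0 \<rho> \<and> (x n - a) * g v = 1"
      unfolding W_def by blast
    then obtain v where v: "\<And>n. v n \<in> ball 0 \<rho>" "\<And>n. (x n - a) * g (v n) = 1"
      by (elim choice[THEN exE]) blast
    have "\<And>n. v n \<in> cball 0 \<rho>" using v(1) by (simp add: less_imp_le)
    then obtain l r where l: "l \<in> cball 0 \<rho>" "strict_mono r" "(v \<circ> r) \<longlonglongrightarrow> l"
      using compact_cball[of "0::complex" \<rho>] unfolding compact_def by meson
    have "isCont g l"
      using holomorphic_on_imp_continuous_on[OF g(1)] l(1) assms
      by (auto simp: continuous_on_eq_continuous_at)
    then have "(\<lambda>n. g ((v \<circ> r) n)) \<longlonglongrightarrow> g l" using l(3) isCont_tendsto_compose by blast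
    moreover have "(\<lambda>n. (x \<circ> r) n - a) \<longlonglongrightarrow> w - a"
      using LIMSEQ_subseq_LIMSEQ[OF x(2) l(2)] by (intro tendsto_intros)
    ultimately have "(\<lambda>n. ((x \<circ> r) n - a) * g ((v \<circ> r) n)) \<longlonglongrightarrow> (w - a) * g l"
      by (rule tendsto_mult[rotated])
    then have eq: "(w - a) * g l = 1" using v(2) by (simp add: LIMSEQ_const_iff)
    then have "norm l = \<rho>" using \<open>w \<notin> W\<close> l(1) unfolding W_def by force
    then show ?thesis using bound eq by blast
  qed
  show ?thesis
  proof (rule maximum_modulus_frontier[of "poly p" "- W"])
    show "poly p holomorphic_on interior (- W)"
      by (simp add: holomorphic_on_def field_differentiable_def) (meson has_field_derivative_at_within poly_DERIV)
    show "continuous_on (closure (- W)) (poly p)"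
      by (intro continuous_on_poly continuous_on_id)
  qed (use z fr bdd in \<open>auto simp: W_def\<close>)
qed

text \<open>In the exterior coordinate \<open>v\<close>, where 0 is infinity, the Fejer polynomial
  is 1 - (s / v) ^ n times a factor \<open>E\<close> close to 1. So it is much larger for norm v <=
  \<rho>1, where the complement of \<open>U\<close> lies, than on the circle \<rho>, and it has no
  critical points outside the level curve of \<rho>.\<close>

lemma lemniscate_polynomial:
  fixes T U :: "complex set"
  assumes T: "compact T" "path_connected T" "connected (- T)" "a \<in> T" "b \<in> T" "a \<noteq> b"
    and U: "open U" "T \<subseteq> U"
  shows "\<exists>p. (\<forall>z. norm (poly p z) \<le> 1 \<longrightarrow> z \<in> U) \<and> (\<forall>z\<in>T. norm (poly p z) < 1) \<and>
             (\<forall>c. poly (pderiv p) c = 0 \<longrightarrow> norm (poly p c) < 1)"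
proof -
  let ?i = "\<lambda>z. 1 / (z - a)"
  define \<Omega> where "\<Omega> = - ?i ` (T - {a})"
  have "?i b \<notin> \<Omega>" using T unfolding \<Omega>_def by blast
  then have "\<Omega> \<noteq> UNIV" by blast
  have "0 \<in> \<Omega>" unfolding \<Omega>_def by auto
  have "open \<Omega>" "simply_connected \<Omega>"
    unfolding \<Omega>_def by (rule simply_connected_inverted_complement[OF T(1-4)])+
  then obtain f g where f: "f holomorphic_on \<Omega>" and g': "g holomorphic_on ball 0 1" "g 0 = 0" "inj_on g (ball 0 1)"
      and fg: "\<And>z. z \<in> \<Omega> \<Longrightarrow> f z \<in> ball 0 1 \<and> g (f z) = z" and gO: "\<And>v. v \<in> ball 0 1 \<Longrightarrow> g v \<in> \<Omega>"
    by (rule normalized_Riemann_map[OF _ _ \<open>0 \<in> \<Omega>\<close> \<open>\<Omega> \<noteq> UNIV\<close>]) (rule that)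
  note g = g'(1,3,2)
  \<comment> \<open>The complement of \<open>U\<close> together with infinity, in the coordinate 1 /
    (z - a). Its compactness yields a radius \<rho>1 below 1.\<close>
  define C where "C = insert 0 (?i ` (- U))"
  have "C \<subseteq> \<Omega>"
  proof -
    have "?i x = ?i y \<longleftrightarrow> x = y" if "y \<noteq> a" for x y using that by auto
    then show ?thesis using U \<open>a \<in> T\<close> unfolding C_def \<Omega>_def by (auto simp: image_iff simp del: divide_eq_eq eq_divide_eq)
  qed
  have "compact C"
  proof -
    obtain d where d: "d > 0" "ball a d \<subseteq> U" using U T(4) open_contains_ball by blast
    have "norm w \<le> 1 / d" if w: "w \<in> C" for w
    proof -
      consider "w = 0" | z where "z \<notin> U" "w = ?i z" using w unfolding C_def by blast
      then show ?thesis
      proof cases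
        case 2
        then have "d \<le> norm (z - a)" using d by (auto simp: dist_norm norm_minus_commute subset_iff not_less)
        then show ?thesis using 2 d by (simp add: norm_divide frac_le)
      qed (use d in auto)
    qed
    then have "bounded C" by (rule boundedI)
    have "- C = {w. w \<noteq> 0} \<inter> (\<lambda>w. a + 1 / w) -` U"
    proof (intro equalityI subsetI)
      fix w assume w: "w \<in> - C"
      then have "w \<noteq> 0" "?i (a + 1 / w) = w" by (auto simp: C_def)
      then show "w \<in> {w. w \<noteq> 0} \<inter> (\<lambda>w. a + 1 / w) -` U"
        using w unfolding C_def by (metis (mono_tags, lifting) ComplD ComplI IntI image_eqI insertI2 mem_Collect_eq vimageI)
    next
      fix w assume "w \<in> {w. w \<noteq> 0} \<inter> (\<lambda>w. a + 1 / w) -` U"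
      then show "w \<in> - C" unfolding C_def by auto
    qed
    moreover have "open \<dots>"
      using U by (intro continuous_open_preimage continuous_intros open_Collect_neq) auto
    ultimately have "closed C" by (simp add: closed_def)
    then show ?thesis using \<open>bounded C\<close> compact_eq_bounded_closed by blast
  qed
  then have "compact (f ` C)"
    using \<open>C \<subseteq> \<Omega>\<close> by (intro compact_continuous_image holomorphic_on_imp_continuous_on
        holomorphic_on_subset[OF f])
  moreover have "f ` C \<subseteq> ball 0 1" using fg \<open>C \<subseteq> \<Omega>\<close> by blast
  ultimately obtain \<rho>1 where \<rho>1: "0 < \<rho>1" "\<rho>1 < 1" "\<And>w. w \<in> C \<Longrightarrow> norm (f w) \<le> \<rho>1"
  proof -
    obtain y where y: "y \<in> C" "\<And>w. w \<in> C \<Longrightarrow> norm (f w) \<le> norm (f y)"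
      using continuous_attains_sup[of "f ` C" norm] \<open>compact (f ` C)\<close>
      by (auto simp: C_def intro: continuous_intros)
    have "norm (f y) < 1" using y \<open>f ` C \<subseteq> ball 0 1\<close> by auto
    then have "norm (f w) \<le> (norm (f y) + 1) / 2" if "w \<in> C" for w
      using y(2)[OF that] by (simp add: field_simps)
    then show thesis
      using that[of "(norm (f y) + 1) / 2"] \<open>norm (f y) < 1\<close> by (simp add: add_nonneg_pos)
  qed
  \<comment> \<open>The numbers \<rho>1 < \<rho> < s < t < 1 are equally spaced: off
    \<open>U\<close> one has norm v <= \<rho>1, on \<rho> the polynomial is bounded from above,
    \<open>s\<close> carries the zeros and \<open>t\<close> the Cauchy estimate.\<close>
  define \<rho> where "\<rho> = (3 * \<rho>1 + 1) / 4"
  define s where "s = (\<rho>1 + 1) / 2"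
  define t where "t = (\<rho>1 + 3) / 4"
  have ord: "\<rho>1 < \<rho>" "0 < \<rho>" "\<rho> < s" "s < t" "t < 1" using \<rho>1 by (auto simp: \<rho>_def s_def t_def)
  obtain M where M: "\<And>u v. norm u = t \<Longrightarrow> norm v \<le> \<rho> \<Longrightarrow>
      norm (1 / (u - v) - deriv g v / (g u - g v)) \<le> M"
    using log_difference_kernel_bounded[OF g(1,2), of \<rho> t] ord by auto
  have "(\<lambda>n. real n * (s / t) ^ n * (M / (1 - s / t))) \<longlonglongrightarrow> 0 * (M / (1 - s / t))"
    using ord by (intro tendsto_intros powser_times_n_limit_0) auto
  then have "eventually (\<lambda>n. real n * (s / t) ^ n * (M / (1 - s / t)) < 1/4) sequentially"
    by (intro order_tendstoD) auto
  moreover have "eventually (\<lambda>n. (\<rho> / \<rho>1) ^ n \<ge> 14) sequentially"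
  proof -
    have gt: "\<rho> / \<rho>1 > 1" using ord \<rho>1 by (simp add: field_simps)
    then obtain N where "14 < (\<rho> / \<rho>1) ^ N" using real_arch_pow by blast
    then have "14 \<le> (\<rho> / \<rho>1) ^ n" if "n \<ge> N" for n
      using power_increasing[OF that, of "\<rho> / \<rho>1"] gt by linarith
    then show ?thesis unfolding eventually_sequentially by blast
  qed
  ultimately have "eventually (\<lambda>n. n > 0 \<and> real n * (s / t) ^ n * (M / (1 - s / t)) < 1/4 \<and> (\<rho> / \<rho>1) ^ n \<ge> 14) sequentially"
    by (intro eventually_conj eventually_gt_at_top)
  from eventually_happens'[OF sequentially_bot this]
  obtain n where n: "n > 0" "real n * (s / t) ^ n * (M / (1 - s / t)) < 1/4" "(\<rho> / \<rho>1) ^ n \<ge> 14"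
    by blast
  define e where "e = real n * (M * (s / t) ^ n / (1 - s / t))"
  have e: "e < 1/4" using n(2) by (simp add: e_def mult_ac)
  obtain q E where q: "\<And>v. v \<in> cball 0 \<rho> - {0} \<Longrightarrow> poly q (1 / g v) = (1 - (of_real s / v) ^ n) * E v"
      and E: "E holomorphic_on ball 0 s" "E 0 = 1"
      and dE: "\<And>v. v \<in> cball 0 \<rho> \<Longrightarrow> norm (deriv E v) \<le> e * norm (E v)"
    using fejer_polynomial[OF g ord(2-5) n(1) M] unfolding e_def by blast
  have E1: "norm (E v - 1) \<le> 1/2" if "norm v \<le> \<rho>" for v
    using small_log_derivative_imp_near_1[OF E(1), of \<rho> e v] ord E(2) dE e that by auto
  have E2: "norm (E v) \<le> 3/2" "norm (E v) \<ge> 1/2" if "norm v \<le> \<rho>" for v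
    using E1[OF that] norm_triangle_ineq[of "E v - 1" 1] norm_triangle_ineq[of "1 - E v" "E v"]
    by (auto simp: norm_minus_commute)
  \<comment> \<open>\<open>x\<close> is the modulus of (s / v) ^ n on the circle \<rho>. As
    \<open>E\<close> lies within 1/2 of 1, \<open>q\<close> is there at most (1 + x) * 3/2, so at
    most 3 * x. Off \<open>U\<close> the power is at least 14 * x, so \<open>q\<close> is at least
    13 * x / 2. The scale 6 * x separates the two.\<close>
  define x where "x = (s / \<rho>) ^ n"
  have x: "x \<ge> 1" using ord unfolding x_def by (intro one_le_power) auto
  define p where "p = smult (of_real (1 / (6 * x))) (q \<circ>\<^sub>p [:- a, 1:])"
  have p: "poly p z = poly q (z - a) / of_real (6 * x)" for z
    by (simp add: p_def poly_pcompose)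
  have p': "poly (pderiv p) z = poly (pderiv q) (z - a) / of_real (6 * x)" for z
    by (simp add: p_def pderiv_smult pderiv_pcompose poly_pcompose pderiv_pCons)
  have eqv: "v \<noteq> 0" "g v \<noteq> 0" "z - a = 1 / g v" if "(z - a) * g v = 1" for z v
    using that g(3) by (auto simp: mult_diff_eq_1_iff)
  have inside: "norm (poly p z) \<le> 1/2" if "\<not> (\<exists>v\<in>ball 0 \<rho>. (z - a) * g v = 1)" for z
  proof (rule polynomial_max_modulus_inside[OF g ord(2) _ _ that])
    show "norm (poly p z) \<le> 1/2" if v: "norm v = \<rho>" "(z - a) * g v = 1" for z v
    proof -
      have "norm (poly q (1 / g v)) = norm (1 - (of_real s / v) ^ n) * norm (E v)"
        using q[of v] v eqv[OF v(2)] by (simp add: norm_mult)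
      also have "\<dots> \<le> (1 + x) * (3/2)"
      proof (intro mult_mono)
        show "norm (1 - (of_real s / v) ^ n) \<le> 1 + x"
          using norm_triangle_ineq4[of 1 "(of_real s / v) ^ n"] v ord
          by (simp add: x_def norm_power norm_divide)
      qed (use E2[of v] v x in auto)
      also have "\<dots> \<le> 3 * x" using x by simp
      finally show ?thesis using x eqv(3)[OF v(2)] by (simp add: p norm_divide field_simps)
    qed
  qed (use ord in auto)
  have "norm (poly p z) < 1" if "z \<in> T" for z
  proof -
    have "\<not> (\<exists>v\<in>ball 0 \<rho>. (z - a) * g v = 1)"
    proof
      assume "\<exists>v\<in>ball 0 \<rho>. (z - a) * g v = 1"
      then obtain v where v: "v \<in> ball 0 \<rho>" "(z - a) * g v = 1" by blast
      then have "g v = ?i z" "z \<noteq> a" by (simp_all add: mult_diff_eq_1_iff)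
      moreover have "g v \<in> \<Omega>" using v ord by (intro gO) auto
      ultimately show False using \<open>z \<in> T\<close> unfolding \<Omega>_def by blast
    qed
    then show ?thesis using inside[of z] by simp
  qed
  moreover have "z \<in> U" if "norm (poly p z) \<le> 1" for z
  proof (rule ccontr)
    assume "z \<notin> U"
    then have z: "z \<noteq> a" "?i z \<in> C" using T U unfolding C_def by auto
    define v where "v = f (?i z)"
    have v: "norm v \<le> \<rho>1" "g v = ?i z"
      using \<rho>1(3)[OF z(2)] fg[of "?i z"] z(2) \<open>C \<subseteq> \<Omega>\<close> by (auto simp: v_def)
    have "v \<noteq> 0" using v(2) z(1) g(3) by auto
    have "14 * x \<le> (\<rho> / \<rho>1) ^ n * x" using n(3) x by (intro mult_right_mono) auto
    also have "\<dots> = (s / \<rho>1) ^ n" using ord \<rho>1 by (simp add: x_def power_divide)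
    also have "\<dots> \<le> (s / norm v) ^ n"
      using v(1) ord \<rho>1 \<open>v \<noteq> 0\<close> by (intro power_mono divide_left_mono) auto
    finally have "14 * x \<le> norm ((of_real s / v) ^ n)" using ord by (simp add: norm_power norm_divide)
    then have "13 * x \<le> norm (1 - (of_real s / v) ^ n)"
      using norm_triangle_ineq2[of "(of_real s / v) ^ n" 1] x by (simp add: norm_minus_commute)
    then have "13 * x * (1/2) \<le> norm (1 - (of_real s / v) ^ n) * norm (E v)"
      using E2(2)[of v] v(1) ord x by (intro mult_mono) auto
    also have "\<dots> = norm (poly q (z - a))"
      using q[of v] v ord \<open>v \<noteq> 0\<close> by (simp add: norm_mult)
    finally have "norm (poly p z) > 1" using x by (simp add: p norm_divide field_simps)
    then show False using that by simp
  qed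
  moreover have "norm (poly p c) < 1" if c: "poly (pderiv p) c = 0" for c
  proof -
    \<comment> \<open>A critical point outside the curve would make the derivative of (1 - y) * E
      vanish, where y = (s / v) ^ n. The contribution n * norm y of the power would then be balanced
      by at most 2 * e * norm y, as norm y >= 1; but n exceeds 2 * e.\<close>
    have "\<not> (\<exists>v\<in>ball 0 \<rho>. (c - a) * g v = 1)"
    proof
      assume "\<exists>v\<in>ball 0 \<rho>. (c - a) * g v = 1"
      then obtain v where v: "v \<in> ball 0 \<rho>" "(c - a) * g v = 1" by blast
      note nz = eqv[OF v(2)]
      have dq: "poly (pderiv q) (1 / g v) = 0" using c x nz(3) by (simp add: p')
      have dg: "(g has_field_derivative deriv g v) (at v)"
        using v ord by (intro holomorphic_derivI[OF g(1)]) auto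
      have "((\<lambda>v. 1 / g v) has_field_derivative - deriv g v / (g v)\<^sup>2) (at v)"
        by (rule derivative_eq_intros dg refl nz)+ (simp add: power2_eq_square)
      then have "((\<lambda>v. poly q (1 / g v)) has_field_derivative
           poly (pderiv q) (1 / g v) * (- deriv g v / (g v)\<^sup>2)) (at v)"
        by (rule DERIV_chain2[OF poly_DERIV])
      then have "((\<lambda>v. poly q (1 / g v)) has_field_derivative 0) (at v)" using dq by simp
      then have D1: "((\<lambda>v. (1 - (of_real s / v) ^ n) * E v) has_field_derivative 0) (at v)"
        by (rule has_field_derivative_transform_within_open[of _ _ _ "ball 0 \<rho> - {0}"])
           (use v nz q in auto)
      define y where "y = (of_real s / v) ^ n"
      have "((\<lambda>v. of_real s / v) has_field_derivative - of_real s / v\<^sup>2) (at v)"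
        by (rule derivative_eq_intros refl nz)+ (simp add: power2_eq_square)
      then have "((\<lambda>v. (of_real s / v) ^ n) has_field_derivative - (of_nat n / v) * y) (at v)"
        using DERIV_power[of "\<lambda>v. of_real s / v" "- of_real s / v\<^sup>2" v UNIV n] n(1) nz
        by (cases n) (simp_all add: y_def power2_eq_square)
      from DERIV_diff[OF DERIV_const this, of 1]
      have "((\<lambda>v. 1 - (of_real s / v) ^ n) has_field_derivative (of_nat n / v) * y) (at v)"
        by simp
      moreover have "(E has_field_derivative deriv E v) (at v)"
        using v ord by (intro holomorphic_derivI[OF E(1)]) auto
      ultimately have "((\<lambda>v. (1 - (of_real s / v) ^ n) * E v) has_field_derivative
          (of_nat n / v) * y * E v + deriv E v * (1 - y)) (at v)"
        unfolding y_def by (rule DERIV_mult)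
      then have "(of_nat n / v) * y * E v + deriv E v * (1 - y) = 0"
        using D1 DERIV_unique by blast
      then have "of_nat n * y * E v = v * (deriv E v * (y - 1))"
        using nz(1) by (simp add: field_simps)
      then have "real n * norm y * norm (E v) = norm v * (norm (deriv E v) * norm (y - 1))"
        by (metis norm_mult norm_of_nat)
      also have "\<dots> \<le> 1 * ((e * norm (E v)) * (2 * norm y))"
      proof (intro mult_mono)
        have "1 \<le> (s / norm v) ^ n" using v ord nz by (intro one_le_power) (auto simp: field_simps)
        then have "1 \<le> norm y" using ord by (simp add: y_def norm_power norm_divide)
        then show "norm (y - 1) \<le> 2 * norm y" using norm_triangle_ineq4[of y 1] by simp
      qed (use v ord dE[of v] order_trans[OF norm_ge_zero dE[of v]] in auto)
      also have "\<dots> = (2 * e) * (norm y * norm (E v))" by simp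
      finally have "(real n - 2 * e) * (norm y * norm (E v)) \<le> 0" by (simp add: algebra_simps)
      moreover have "real n - 2 * e > 0" using n(1) e by linarith
      moreover have "norm y * norm (E v) > 0"
        using E2(2)[of v] v ord nz(1) by (intro mult_pos_pos) (auto simp: y_def)
      ultimately show False by (smt (verit) mult_pos_pos)
    qed
    then show ?thesis using inside[of c] by simp
  qed
  ultimately show ?thesis by blast
qed

section \<open>Polynomials with prescribed critical values\<close>

lemma compact_box_fun:
  fixes S :: "'i \<Rightarrow> 'a::topological_space set"
  assumes "\<And>j. compact (S j)"
  shows "compact {x. \<forall>j. x j \<in> S j}"
proof -
  have "compactin (product_topology (\<lambda>_. euclidean) UNIV) (PiE UNIV S)"
    unfolding compactin_PiE using assms by simp
  moreover have "PiE UNIV S = {x. \<forall>j. x j \<in> S j}" by (auto simp: PiE_def)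
  ultimately show ?thesis by (simp add: euclidean_product_topology)
qed

text \<open>Minimising the residual plus a small multiple of the distance to \<open>x0\<close> (as in Ekeland's
  principle) needs only directional derivatives, and no finite-dimensional type whose dimension
  depends on \<open>m\<close>.\<close>

lemma solvable_near_if_directional_right_inverse:
  fixes F :: "nat \<Rightarrow> (nat \<Rightarrow> complex) \<Rightarrow> complex"
  defines "B x0 m r \<equiv> {x. \<forall>j. x j \<in> (if j < m then cball (x0 j) r else {x0 j})}"
  assumes "r > 0" "C > 0"
    and cont: "\<And>i. i < N \<Longrightarrow> continuous_on (B x0 m r) (F i)"
    and dir: "\<And>x \<rho>. x \<in> B x0 m r \<Longrightarrow> \<exists>h. (\<forall>j\<ge>m. h j = 0) \<and>
        (\<Sum>j<m. norm (h j)) \<le> C * (\<Sum>i<N. norm (\<rho> i)) \<and>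
        (\<forall>i<N. ((\<lambda>t. F i (\<lambda>j. x j + t * h j)) has_field_derivative - \<rho> i) (at 0))"
    and y: "(\<Sum>i<N. norm (F i x0 - y i)) < r / (2 * C)"
  shows "\<exists>x\<in>B x0 m r. \<forall>i<N. F i x = y i"
proof -
  define d where "d x = (\<Sum>j<m. norm (x j - x0 j))" for x
  \<comment> \<open>Along \<open>h\<close> a small step \<open>t\<close> lowers the residual by more
    than t * R / 2, while \<open>d\<close> grows by at most t * C * R; with the weight 1 / (2 * C)
    the gain wins.\<close>
  define \<phi> where "\<phi> x = (\<Sum>i<N. norm (F i x - y i)) + d x / (2 * C)" for x
  have "compact (B x0 m r)" unfolding B_def by (rule compact_box_fun) auto
  have x0: "x0 \<in> B x0 m r" using \<open>r > 0\<close> by (simp add: B_def)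
  have "continuous_on (B x0 m r) \<phi>"
    unfolding \<phi>_def d_def using cont \<open>C > 0\<close>
    by (intro continuous_intros continuous_on_product_then_coordinatewise[OF continuous_on_id]) auto
  then obtain x where x: "x \<in> B x0 m r" "\<And>x'. x' \<in> B x0 m r \<Longrightarrow> \<phi> x \<le> \<phi> x'"
    using continuous_attains_inf[OF \<open>compact (B x0 m r)\<close>] x0 by blast
  define R where "R = (\<Sum>i<N. norm (F i x - y i))"
  have "R \<ge> 0" unfolding R_def by (intro sum_nonneg) auto
  have "R = 0"
  proof (rule ccontr)
    assume "R \<noteq> 0"
    with \<open>R \<ge> 0\<close> have "R > 0" by simp
    \<comment> \<open>The hypothesis on \<open>y\<close> keeps the minimiser off the boundary of the
      box, so that a step in any direction is possible.\<close>
    have "d x / (2 * C) \<le> \<phi> x" using \<open>R \<ge> 0\<close> by (simp add: \<phi>_def R_def)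
    also have "\<phi> x \<le> \<phi> x0" using x(2) x0 .
    also have "\<phi> x0 < r / (2 * C)" using y by (simp add: \<phi>_def d_def)
    finally have "d x < r" using \<open>C > 0\<close> by (simp add: divide_strict_right_mono field_simps)
    define \<rho> where "\<rho> i = F i x - y i" for i
    obtain h where h: "\<And>j. j \<ge> m \<Longrightarrow> h j = 0" "(\<Sum>j<m. norm (h j)) \<le> C * R"
        "\<And>i. i < N \<Longrightarrow> ((\<lambda>t. F i (\<lambda>j. x j + t * h j)) has_field_derivative - \<rho> i) (at 0)"
      using dir[OF x(1), of \<rho>] unfolding \<rho>_def R_def by auto
    define z where "z t = (\<lambda>j. x j + t * h j)" for t
    have "((\<lambda>t. \<Sum>i<N. norm ((F i (z t) - F i x) / t + \<rho> i)) \<longlongrightarrow> (\<Sum>i<N. norm (- \<rho> i + \<rho> i))) (at 0)"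
    proof (intro tendsto_sum tendsto_norm tendsto_add tendsto_const)
      fix i assume "i \<in> {..<N}"
      then show "((\<lambda>t. (F i (z t) - F i x) / t) \<longlongrightarrow> - \<rho> i) (at 0)"
        using h(3)[of i] unfolding DERIV_def z_def by simp
    qed
    then have "((\<lambda>t. \<Sum>i<N. norm ((F i (z t) - F i x) / t + \<rho> i)) \<longlongrightarrow> 0) (at 0)" by simp
    then have "eventually (\<lambda>t. (\<Sum>i<N. norm ((F i (z t) - F i x) / t + \<rho> i)) < R / 2) (at 0)"
      using \<open>R > 0\<close> by (intro order_tendstoD) auto
    then obtain \<delta> where \<delta>: "\<delta> > 0" "\<And>t. t \<noteq> 0 \<Longrightarrow> norm t < \<delta> \<Longrightarrow>
        (\<Sum>i<N. norm ((F i (z t) - F i x) / t + \<rho> i)) < R / 2"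
      unfolding eventually_at by (auto simp: dist_norm)
    define H where "H = (\<Sum>j<m. norm (h j))"
    have "H \<ge> 0" unfolding H_def by (intro sum_nonneg) auto
    \<comment> \<open>The three bounds keep the difference quotients accurate, 1 - t nonnegative and
      the new point in the box.\<close>
    define t where "t = min (\<delta> / 2) (min 1 ((r - d x) / (H + 1)))"
    have "(r - d x) / (H + 1) > 0" using \<open>d x < r\<close> \<open>H \<ge> 0\<close> by simp
    then have t: "t > 0" "t < \<delta>" "t \<le> 1" using \<delta>(1) unfolding t_def by linarith+
    have "t \<le> (r - d x) / (H + 1)" unfolding t_def by linarith
    then have "t * (H + 1) \<le> r - d x" using \<open>H \<ge> 0\<close> by (simp add: pos_le_divide_eq)
    then have tH: "t * H \<le> r - d x" using t by (simp add: algebra_simps)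
    have dz: "d (z t) \<le> d x + t * H"
    proof -
      have "d (z t) \<le> (\<Sum>j<m. norm (x j - x0 j) + t * norm (h j))"
        unfolding d_def
      proof (rule sum_mono)
        fix j
        have "norm (z t j - x0 j) = norm ((x j - x0 j) + of_real t * h j)" by (simp add: z_def algebra_simps)
        also have "\<dots> \<le> norm (x j - x0 j) + t * norm (h j)"
          using norm_triangle_ineq[of "x j - x0 j" "of_real t * h j"] t by (simp add: norm_mult)
        finally show "norm (z t j - x0 j) \<le> norm (x j - x0 j) + t * norm (h j)" .
      qed
      then show ?thesis by (simp add: d_def H_def sum.distrib sum_distrib_left)
    qed
    have zB: "z t \<in> B x0 m r"
    proof -
      have "norm (z t j - x0 j) \<le> r" if "j < m" for j
      proof -
        have "norm (z t j - x0 j) \<le> d (z t)"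
          unfolding d_def using that by (intro member_le_sum) auto
        then show ?thesis using dz tH by linarith
      qed
      moreover have "z t j = x0 j" if "\<not> j < m" for j
        using that x(1) h(1)[of j] by (auto simp: z_def B_def split: if_splits dest!: spec[of _ j])
      ultimately show ?thesis by (auto simp: B_def dist_norm norm_minus_commute)
    qed
    have "(\<Sum>i<N. norm (F i (z t) - y i)) \<le> (\<Sum>i<N. t * norm ((F i (z t) - F i x) / t + \<rho> i) + (1 - t) * norm (\<rho> i))"
    proof (rule sum_mono)
      fix i
      have "F i (z t) - y i = of_real t * ((F i (z t) - F i x) / t + \<rho> i) + of_real (1 - t) * \<rho> i"
      proof -
        have "of_real t * ((F i (z t) - F i x) / of_real t) = F i (z t) - F i x" using t by simp
        then show ?thesis by (simp add: \<rho>_def distrib_left) (simp add: algebra_simps)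
      qed
      also have "norm \<dots> \<le> norm (of_real t * ((F i (z t) - F i x) / t + \<rho> i)) + norm (of_real (1 - t) * \<rho> i)"
        by (rule norm_triangle_ineq)
      also have "\<dots> = t * norm ((F i (z t) - F i x) / t + \<rho> i) + (1 - t) * norm (\<rho> i)"
        using t by (simp only: norm_mult norm_of_real abs_of_nonneg)
      finally show "norm (F i (z t) - y i) \<le> t * norm ((F i (z t) - F i x) / t + \<rho> i) + (1 - t) * norm (\<rho> i)" .
    qed
    also have "\<dots> = t * (\<Sum>i<N. norm ((F i (z t) - F i x) / t + \<rho> i)) + (1 - t) * R"
      by (simp add: sum.distrib sum_distrib_left R_def \<rho>_def)
    also have "\<dots> < t * (R / 2) + (1 - t) * R"
      using \<delta>(2)[of t] t by (intro add_strict_right_mono mult_strict_left_mono) auto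
    finally have A: "(\<Sum>i<N. norm (F i (z t) - y i)) < R - t * R / 2" by (simp add: algebra_simps)
    have "d (z t) / (2 * C) \<le> (d x + t * (C * R)) / (2 * C)"
    proof (rule divide_right_mono)
      have "t * H \<le> t * (C * R)" using h(2) t by (intro mult_left_mono) (auto simp: H_def)
      then show "d (z t) \<le> d x + t * (C * R)" using dz by linarith
    qed (use \<open>C > 0\<close> in auto)
    also have "\<dots> = d x / (2 * C) + t * R / 2" using \<open>C > 0\<close> by (simp add: add_divide_distrib)
    finally have "\<phi> (z t) < \<phi> x" using A by (simp add: \<phi>_def R_def)
    then show False using x(2)[OF zB] by simp
  qed
  then have "\<forall>i<N. F i x = y i"
    unfolding R_def by (subst (asm) sum_nonneg_eq_0_iff) auto
  then show ?thesis using x(1) by blast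
qed

section \<open>Antiderivatives and root products, coefficient by coefficient\<close>

definition poly_antideriv :: "'a::field_char_0 poly \<Rightarrow> 'a poly" where
  "poly_antideriv p = (\<Sum>i\<le>degree p. monom (coeff p i / of_nat (Suc i)) (Suc i))"

lemma coeff_poly_antideriv:
  "coeff (poly_antideriv p) k = (case k of 0 \<Rightarrow> 0 | Suc i \<Rightarrow> coeff p i / of_nat (Suc i))"
proof (cases k)
  case (Suc i)
  have "coeff (poly_antideriv p) k = (\<Sum>l\<le>degree p. if l = i then coeff p i / of_nat (Suc i) else 0)"
    unfolding poly_antideriv_def coeff_sum coeff_monom Suc by (intro sum.cong) auto
  then show ?thesis using Suc by (auto simp: coeff_eq_0)
qed (simp add: poly_antideriv_def coeff_sum)

lemma pderiv_poly_antideriv [simp]: "pderiv (poly_antideriv p) = p"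
  by (rule poly_eqI) (simp add: coeff_pderiv coeff_poly_antideriv del: of_nat_Suc)

lemma poly_antideriv_pderiv: "poly_antideriv (pderiv p) = p - [:poly p 0:]"
  by (rule poly_eqI) (auto simp: coeff_pderiv coeff_poly_antideriv poly_0_coeff_0 coeff_pCons
      simp del: of_nat_Suc split: nat.split)

lemma poly_antideriv_smult: "poly_antideriv (smult a p) = smult a (poly_antideriv p)"
  by (rule poly_eqI) (simp add: coeff_poly_antideriv split: nat.split)

lemma degree_poly_antideriv_le: "degree (poly_antideriv p) \<le> Suc (degree p)"
  by (rule degree_le) (auto simp: coeff_poly_antideriv coeff_eq_0 split: nat.split)

lemma poly_eq_sum_upto:
  fixes p :: "'a::comm_ring_1 poly"
  assumes "degree p \<le> n"
  shows "poly p z = (\<Sum>i\<le>n. coeff p i * z ^ i)"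
  unfolding poly_altdef
  by (intro sum.mono_neutral_left) (use assms in \<open>auto simp: coeff_eq_0\<close>)

lemma poly_antideriv_eq_sum_upto:
  assumes "degree p \<le> n"
  shows "poly (poly_antideriv p) z = (\<Sum>i\<le>n. coeff p i * z ^ Suc i / of_nat (Suc i))"
proof -
  have "poly (poly_antideriv p) z = (\<Sum>i\<le>Suc n. coeff (poly_antideriv p) i * z ^ i)"
    using assms degree_poly_antideriv_le[of p] by (intro poly_eq_sum_upto) auto
  also have "\<dots> = (\<Sum>i\<le>n. coeff p i * z ^ Suc i / of_nat (Suc i))"
    by (subst sum.atMost_Suc_shift) (simp add: coeff_poly_antideriv)
  finally show ?thesis .
qed

lemma coeff_linear_mult:
  fixes p :: "'a::comm_ring_1 poly"
  shows "coeff ([:c, 1:] * p) k = c * coeff p k + (case k of 0 \<Rightarrow> 0 | Suc l \<Rightarrow> coeff p l)"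
  by (cases k) (auto simp: coeff_pCons)

definition root_poly :: "'i set \<Rightarrow> ('i \<Rightarrow> 'a::comm_ring_1) \<Rightarrow> 'a poly" where
  "root_poly A x = (\<Prod>j\<in>A. [:- x j, 1:])"

lemma poly_root_poly: "poly (root_poly A x) z = (\<Prod>j\<in>A. z - x j)"
  by (simp add: root_poly_def poly_prod)

lemma root_poly_insert:
  "finite A \<Longrightarrow> j \<notin> A \<Longrightarrow> root_poly (insert j A) x = [:- x j, 1:] * root_poly A x"
  by (simp add: root_poly_def)

lemma degree_root_poly: "degree (root_poly A (x :: 'i \<Rightarrow> 'a::idom)) = card A"
  unfolding root_poly_def by (subst degree_prod_eq_sum_degree) auto

lemma tendsto_coeff_root_poly:
  fixes x :: "'b \<Rightarrow> 'i \<Rightarrow> 'a::real_normed_field"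
  assumes "finite A" "\<And>j. j \<in> A \<Longrightarrow> ((\<lambda>s. x s j) \<longlongrightarrow> l j) F"
  shows "((\<lambda>s. coeff (root_poly A (x s)) k) \<longlongrightarrow> coeff (root_poly A l) k) F"
  using assms
proof (induction A arbitrary: k rule: finite_induct)
  case (insert j A)
  then show ?case
    unfolding root_poly_insert[OF insert.hyps] coeff_linear_mult
    by (cases k) (auto intro!: tendsto_intros)
qed (simp add: root_poly_def)

text \<open>The product rule, taken for single coefficients; with bounded degree these determine all
  evaluations as finite sums.\<close>

lemma coeff_root_poly_has_derivative:
  fixes x h :: "'i \<Rightarrow> 'a::real_normed_field"
  assumes "finite A"
  shows "((\<lambda>t. coeff (root_poly A (\<lambda>j. x j + t * h j)) k) has_field_derivative
            coeff (\<Sum>j\<in>A. smult (- h j) (root_poly (A - {j}) x)) k) (at 0)"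
  using assms
proof (induction A arbitrary: k rule: finite_induct)
  case (insert j A)
  let ?D = "\<Sum>j\<in>A. smult (- h j) (root_poly (A - {j}) x)"
  have "(\<Sum>i\<in>insert j A. smult (- h i) (root_poly (insert j A - {i}) x))
      = smult (- h j) (root_poly A x) + (\<Sum>i\<in>A. smult (- h i) (root_poly (insert j A - {i}) x))"
    using insert.hyps by simp
  also have "(\<Sum>i\<in>A. smult (- h i) (root_poly (insert j A - {i}) x)) = [:- x j, 1:] * ?D"
    unfolding sum_distrib_left
  proof (rule sum.cong)
    fix i assume "i \<in> A"
    then have "insert j A - {i} = insert j (A - {i})" using insert.hyps by auto
    then show "smult (- h i) (root_poly (insert j A - {i}) x)
        = [:- x j, 1:] * smult (- h i) (root_poly (A - {i}) x)"
      using insert.hyps by (simp only: root_poly_insert finite_Diff Diff_iff simp_thms mult_smult_right)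
  qed simp
  finally have eq: "coeff (\<Sum>i\<in>insert j A. smult (- h i) (root_poly (insert j A - {i}) x)) k
      = - h j * coeff (root_poly A x) k + (- x j * coeff ?D k + (case k of 0 \<Rightarrow> 0 | Suc l \<Rightarrow> coeff ?D l))"
    by (simp only: coeff_add coeff_linear_mult coeff_smult)
  have 1: "((\<lambda>t. - (x j + t * h j)) has_field_derivative - h j) (at 0)"
    by (auto intro!: derivative_eq_intros)
  have 2: "((\<lambda>t. case k of 0 \<Rightarrow> 0 | Suc l \<Rightarrow> coeff (root_poly A (\<lambda>j. x j + t * h j)) l)
      has_field_derivative (case k of 0 \<Rightarrow> 0 | Suc l \<Rightarrow> coeff ?D l)) (at 0)"
    using insert.IH by (cases k) auto
  show ?case
    unfolding eq root_poly_insert[OF insert.hyps] coeff_linear_mult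
    by (rule DERIV_cong[OF DERIV_add[OF DERIV_mult[OF 1 insert.IH] 2]]) simp
qed (simp add: root_poly_def)

lemma poly_eqI_roots:
  fixes p q :: "'a::idom poly"
  assumes "inj_on x {..<N}" "degree p < N" "degree q < N" "\<And>i. i < N \<Longrightarrow> poly p (x i) = poly q (x i)"
  shows "p = q"
proof (rule ccontr)
  assume "p \<noteq> q"
  then have nz: "p - q \<noteq> 0" by simp
  have "x ` {..<N} \<subseteq> {z. poly (p - q) z = 0}" using assms(4) by auto
  then have "card (x ` {..<N}) \<le> card {z. poly (p - q) z = 0}"
    by (intro card_mono poly_roots_finite nz)
  also have "\<dots> \<le> degree (p - q)" by (rule card_poly_roots_bound[OF nz])
  also have "\<dots> < N" by (rule degree_diff_less[OF assms(2,3)])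
  finally show False using assms(1) by (simp add: card_image)
qed

text \<open>The common degree bound makes evaluation a finite sum of fixed length, so the polynomial
  and the point may vary together.\<close>

lemma tendsto_poly_family:
  fixes P :: "'b \<Rightarrow> 'a::real_normed_field poly"
  assumes "\<And>k. ((\<lambda>s. coeff (P s) k) \<longlongrightarrow> coeff Q k) F" "\<And>s. degree (P s) \<le> n" "degree Q \<le> n"
    and "(z \<longlongrightarrow> w) F"
  shows "((\<lambda>s. poly (P s) (z s)) \<longlongrightarrow> poly Q w) F"
  unfolding poly_eq_sum_upto[OF assms(2)] poly_eq_sum_upto[OF assms(3)]
  by (intro tendsto_intros assms)

lemma pderiv_sum: "pderiv (\<Sum>i\<in>A. f i) = (\<Sum>i\<in>A. pderiv (f i))"
  by (induction A rule: infinite_finite_induct) (simp_all add: pderiv_add)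

section \<open>Polynomials parametrised by their critical points\<close>

lemma complex_poly_split:
  fixes p :: "complex poly"
  shows "\<exists>x. p = smult (lead_coeff p) (root_poly {..<degree p} x)"
proof (induction "degree p" arbitrary: p)
  case 0
  then obtain c where "p = [:c:]" by (metis degree_eq_zeroE)
  then show ?case by (simp add: root_poly_def)
next
  case (Suc n)
  then have "\<not> constant (poly p)" by (simp add: constant_degree)
  then obtain z where "poly p z = 0" using Fundamental_Theorem_Algebra.fundamental_theorem_of_algebra by blast
  then obtain q where q: "p = [:- z, 1:] * q" by (auto simp: poly_eq_0_iff_dvd dvd_def)
  have "q \<noteq> 0" using q Suc.hyps(2) by auto
  then have "degree p = Suc (degree q)" unfolding q by (subst degree_mult_eq) auto
  then obtain x where x: "q = smult (lead_coeff q) (root_poly {..<n} x)"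
    using Suc.hyps(1)[of q] Suc.hyps(2) by auto
  have "root_poly {..<Suc n} (x(n := z)) = [:- z, 1:] * root_poly {..<n} (x(n := z))"
    by (simp add: lessThan_Suc root_poly_insert)
  also have "root_poly {..<n} (x(n := z)) = root_poly {..<n} x"
    unfolding root_poly_def by (intro prod.cong) auto
  finally have "smult (lead_coeff q) (root_poly {..<Suc n} (x(n := z))) = p"
    using x q by (metis mult_smult_right)
  moreover have "lead_coeff p = lead_coeff q" unfolding q by (subst lead_coeff_mult) simp
  ultimately show ?case using Suc.hyps(2) by metis
qed

text \<open>Polynomials of degree \<open>N + 1\<close> are parametrised by their critical points
  \<open>x 0, \<dots>, x (N - 1)\<close> and their value \<open>x N\<close> at \<open>0\<close>.\<close>

definition critical_poly :: "complex \<Rightarrow> nat \<Rightarrow> (nat \<Rightarrow> complex) \<Rightarrow> complex poly" where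
  "critical_poly a N x = [:x N:] + smult a (poly_antideriv (root_poly {..<N} x))"

lemma pderiv_critical_poly: "pderiv (critical_poly a N x) = smult a (root_poly {..<N} x)"
  by (simp add: critical_poly_def pderiv_add pderiv_smult pderiv_pCons)

lemma degree_critical_poly_le: "degree (critical_poly a N x) \<le> Suc N"
  unfolding critical_poly_def
  using degree_poly_antideriv_le[of "root_poly {..<N} x"] degree_smult_le[of a "poly_antideriv (root_poly {..<N} x)"]
  by (intro degree_add_le) (simp_all add: degree_root_poly)

text \<open>That no \<open>x\<close> occurs on the right matters: it keeps sublevel sets bounded and
  root estimates uniform when the critical points are perturbed.\<close>

lemma coeff_critical_poly_Suc: "coeff (critical_poly a N x) (Suc N) = a / of_nat (Suc N)"
proof -
  have "lead_coeff (root_poly {..<N} x) = 1"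
    unfolding root_poly_def by (subst lead_coeff_prod) simp
  then show ?thesis by (simp add: critical_poly_def coeff_poly_antideriv degree_root_poly del: of_nat_Suc)
qed

lemma critical_poly_exists:
  assumes "degree p = Suc N"
  obtains a x where "a \<noteq> 0" "p = critical_poly a N x"
proof -
  have deg: "degree (pderiv p) = N" using assms by (simp add: degree_pderiv)
  obtain x where x: "pderiv p = smult (lead_coeff (pderiv p)) (root_poly {..<N} x)"
    using complex_poly_split[of "pderiv p"] deg by metis
  have nz: "lead_coeff (pderiv p) \<noteq> 0" using assms by (auto simp: pderiv_eq_0_iff)
  define x' where "x' = x(N := poly p 0)"
  have rx: "root_poly {..<N} x' = root_poly {..<N} x"
    unfolding root_poly_def x'_def by (intro prod.cong) auto
  have "p = [:poly p 0:] + poly_antideriv (pderiv p)" by (simp add: poly_antideriv_pderiv)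
  also have "\<dots> = critical_poly (lead_coeff (pderiv p)) N x'"
    by (subst x) (simp add: critical_poly_def poly_antideriv_smult rx, simp add: x'_def)
  finally show thesis using nz that by blast
qed

lemma tendsto_coeff_critical_poly:
  assumes "\<And>j. j \<le> N \<Longrightarrow> ((\<lambda>s. x s j) \<longlongrightarrow> l j) F"
  shows "((\<lambda>s. coeff (critical_poly a N (x s)) k) \<longlongrightarrow> coeff (critical_poly a N l) k) F"
  unfolding critical_poly_def coeff_add coeff_smult coeff_poly_antideriv coeff_pCons
  using assms
  by (cases k) (auto intro!: tendsto_intros tendsto_coeff_root_poly simp del: of_nat_Suc)

lemma tendsto_critical_poly:
  assumes "\<And>j. j \<le> N \<Longrightarrow> ((\<lambda>s. x s j) \<longlongrightarrow> l j) F" "(z \<longlongrightarrow> w) F"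
  shows "((\<lambda>s. poly (critical_poly a N (x s)) (z s)) \<longlongrightarrow> poly (critical_poly a N l) w) F"
  by (intro tendsto_poly_family[where n = "Suc N"] tendsto_coeff_critical_poly degree_critical_poly_le assms)

text \<open>The critical point moves along with the polynomial, but since the derivative vanishes
  there, its motion has no effect to first order. Only the change of the polynomial, given by
  \<open>h N\<close> and \<open>D\<close>, remains.\<close>

lemma critical_value_has_derivative:
  fixes x h :: "nat \<Rightarrow> complex"
  assumes "i < N"
  defines "D \<equiv> \<Sum>j<N. smult (- h j) (root_poly ({..<N} - {j}) x)"
  shows "((\<lambda>t. poly (critical_poly a N (\<lambda>j. x j + t * h j)) (x i + t * h i)) has_field_derivative
           h N + a * poly (poly_antideriv D) (x i)) (at 0)"
proof -
  define A where "A t = root_poly {..<N} (\<lambda>j. x j + t * h j)" for t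
  have degA: "degree (A t) \<le> N" for t by (simp add: A_def degree_root_poly)
  have degD: "degree D \<le> N"
    unfolding D_def
    by (intro degree_sum_le order_trans[OF degree_smult_le]) (auto simp: degree_root_poly)
  have A0: "poly (A 0) (x i) = 0" using assms by (auto simp: A_def poly_root_poly)
  have c: "((\<lambda>t. coeff (A t) k) has_field_derivative coeff D k) (at 0)" for k
    unfolding A_def D_def by (rule coeff_root_poly_has_derivative) simp
  have "((\<lambda>t. coeff (A t) k * (x i + t * h i) ^ Suc k / of_nat (Suc k)) has_field_derivative
          coeff D k * x i ^ Suc k / of_nat (Suc k) + h i * (coeff (A 0) k * x i ^ k)) (at 0)" for k
  proof -
    have p: "((\<lambda>t. (x i + t * h i) ^ Suc k) has_field_derivative of_nat (Suc k) * (h i * x i ^ k)) (at 0)"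
      by (auto intro!: derivative_eq_intros simp del: of_nat_Suc power_Suc)
    show ?thesis
      by (rule DERIV_cong[OF DERIV_cdivide[OF DERIV_mult[OF c p]]])
         (simp add: add_divide_distrib del: of_nat_Suc power_Suc)
  qed
  then have "((\<lambda>t. \<Sum>k\<le>N. coeff (A t) k * (x i + t * h i) ^ Suc k / of_nat (Suc k)) has_field_derivative
          (\<Sum>k\<le>N. coeff D k * x i ^ Suc k / of_nat (Suc k) + h i * (coeff (A 0) k * x i ^ k))) (at 0)"
    by (intro DERIV_sum)
  also have "(\<Sum>k\<le>N. coeff D k * x i ^ Suc k / of_nat (Suc k) + h i * (coeff (A 0) k * x i ^ k))
      = poly (poly_antideriv D) (x i) + h i * poly (A 0) (x i)"
    unfolding poly_antideriv_eq_sum_upto[OF degD] poly_eq_sum_upto[OF degA]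
    by (simp only: sum.distrib sum_distrib_left)
  finally have S: "((\<lambda>t. poly (poly_antideriv (A t)) (x i + t * h i)) has_field_derivative
      poly (poly_antideriv D) (x i)) (at 0)"
    by (simp only: A0 mult_zero_right add_0_right poly_antideriv_eq_sum_upto[OF degA])
  have "((\<lambda>t. (x N + t * h N) + a * poly (poly_antideriv (A t)) (x i + t * h i)) has_field_derivative
      h N + a * poly (poly_antideriv D) (x i)) (at 0)"
    by (intro DERIV_add DERIV_cmult S) (auto intro!: derivative_eq_intros)
  then show ?thesis by (simp add: critical_poly_def A_def)
qed

section \<open>Prescribing critical values\<close>

lemma finite_inj_separated:
  fixes x :: "nat \<Rightarrow> 'a::metric_space"
  assumes "inj_on x {..<N}"
  obtains \<delta> where "\<delta> > 0" "\<And>i j. i < N \<Longrightarrow> j < N \<Longrightarrow> i \<noteq> j \<Longrightarrow> \<delta> \<le> dist (x i) (x j)"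
proof -
  let ?S = "(\<lambda>(i, j). dist (x i) (x j)) ` {(i, j). i < N \<and> j < N \<and> i \<noteq> j}"
  have "finite {(i, j). i < N \<and> j < N \<and> i \<noteq> j}"
    by (rule finite_subset[of _ "{..<N} \<times> {..<N}"]) auto
  \<comment> \<open>The added 1 keeps the set nonempty for \<open>Min\<close> when there are no
    pairs.\<close>
  then have fin: "finite (insert 1 ?S)" by simp
  have "0 < y" if "y \<in> insert 1 ?S" for y
    using that inj_onD[OF assms] by auto
  then have "Min (insert 1 ?S) > 0" using fin by (subst Min_gr_iff) auto
  moreover have "Min (insert 1 ?S) \<le> dist (x i) (x j)" if "i < N" "j < N" "i \<noteq> j" for i j
    using fin that by (intro Min_le) auto
  ultimately show thesis using that by blast
qed

text \<open>Let \<open>Q\<close> be the Lagrange polynomial of degree below \<open>N\<close> with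
  value \<open>- \<rho> i\<close> at \<open>x i\<close>; then \<open>h\<close> is chosen so that the
  first-order change of \<open>critical_poly\<close> is \<open>Q\<close>. The solution is linear in
  \<rho> with coefficients continuous in \<open>x\<close>, hence bounded on the compact set
  \<open>B\<close>.\<close>

lemma critical_values_directional_right_inverse:
  fixes a :: complex
  assumes "a \<noteq> 0" "compact B" "\<And>x. x \<in> B \<Longrightarrow> inj_on x {..<N}"
  obtains C where "C > 0"
    "\<And>x \<rho>. x \<in> B \<Longrightarrow> \<exists>h. (\<forall>j\<ge>Suc N. h j = 0) \<and>
        (\<Sum>j<Suc N. norm (h j)) \<le> C * (\<Sum>i<N. norm (\<rho> i)) \<and>
        (\<forall>i<N. ((\<lambda>t. poly (critical_poly a N (\<lambda>j. x j + t * h j)) (x i + t * h i)) has_field_derivative - \<rho> i) (at 0))"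
proof -
  define L where "L i x = root_poly ({..<N} - {i}) x" for i and x :: "nat \<Rightarrow> complex"
  define l where "l i x = poly (L i x) (x i)" for i x
  \<comment> \<open>For j < N this solves \<open>smult a D = pderiv Q\<close> at \<open>x j\<close>,
    where only the term with \<open>L j\<close> in \<open>D\<close> survives; for j = N it gives
    \<open>h N = poly Q 0\<close>.\<close>
  define c where "c j i x = (if j < N then poly (pderiv (L i x)) (x j) / (a * l i x * l j x)
                             else - poly (L i x) 0 / l i x)" for j i x
  have degL: "degree (L i x) = N - 1" if "i < N" for i x
    using that by (simp add: L_def degree_root_poly)
  have degL': "degree (L i x) \<le> N" for i x
    by (simp add: L_def degree_root_poly) (metis card_Diff1_le card_lessThan finite_lessThan)
  have degpL: "degree (pderiv (L i x)) \<le> N" for i x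
    using degL'[of i x] by (simp add: degree_pderiv)
  have l0: "l i x \<noteq> 0" if "x \<in> B" "i < N" for i x
    using assms(3)[OF that(1)] that(2) by (auto simp: l_def L_def poly_root_poly inj_on_def)
  have LK: "poly (L i x) (x k) = (if k = i then l i x else 0)" if "i < N" "k < N" for i k x
    using that by (auto simp: l_def L_def poly_root_poly)
  have coordt: "((\<lambda>s. s j) \<longlongrightarrow> x j) (at x within B)" for x :: "nat \<Rightarrow> complex" and j
    using continuous_on_product_coordinates[of j] tendsto_within_subset[OF _ subset_UNIV]
    unfolding continuous_on_def by blast
  have Lt: "((\<lambda>s. coeff (L i s) k) \<longlongrightarrow> coeff (L i x) k) (at x within B)" for i k x
    unfolding L_def by (intro tendsto_coeff_root_poly coordt) auto
  have Lt': "((\<lambda>s. coeff (pderiv (L i s)) k) \<longlongrightarrow> coeff (pderiv (L i x)) k) (at x within B)" for i k x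
    unfolding coeff_pderiv by (intro tendsto_intros Lt)
  have lt: "((\<lambda>s. l i s) \<longlongrightarrow> l i x) (at x within B)" for i x
    unfolding l_def by (intro tendsto_poly_family[where n = N] Lt degL' coordt)
  have "continuous_on B (c j i)" if "i < N" for i j
  proof (cases "j < N")
    case True
    have "((\<lambda>s. poly (pderiv (L i s)) (s j) / (a * l i s * l j s)) \<longlongrightarrow>
        poly (pderiv (L i x)) (x j) / (a * l i x * l j x)) (at x within B)" if "x \<in> B" for x
      using l0[OF that] \<open>i < N\<close> True \<open>a \<noteq> 0\<close>
      by (intro tendsto_intros tendsto_poly_family[where n = N] Lt' degpL coordt lt) auto
    then show ?thesis using True by (simp add: c_def continuous_on_def)
  next
    case False
    have "((\<lambda>s. - poly (L i s) 0 / l i s) \<longlongrightarrow> - poly (L i x) 0 / l i x) (at x within B)" if "x \<in> B" for x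
      using l0[OF that \<open>i < N\<close>]
      by (intro tendsto_intros tendsto_poly_family[where n = N] Lt degL' lt) auto
    then show ?thesis using False by (simp add: c_def continuous_on_def)
  qed
  then have "\<exists>b. \<forall>x\<in>B. norm (c j i x) \<le> b" if "i < N" for i j
    using compact_imp_bounded[OF compact_continuous_image[OF _ \<open>compact B\<close>], of "c j i"] that
    by (auto simp: bounded_iff)
  then obtain b where b: "\<And>i j x. i < N \<Longrightarrow> x \<in> B \<Longrightarrow> norm (c j i x) \<le> b i j"
    by metis
  define C where "C = 1 + (\<Sum>j<Suc N. \<Sum>i<N. \<bar>b i j\<bar>)"
  have "C > 0" unfolding C_def by (intro add_pos_nonneg sum_nonneg) auto
  moreover have "\<exists>h. (\<forall>j\<ge>Suc N. h j = 0) \<and>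
        (\<Sum>j<Suc N. norm (h j)) \<le> C * (\<Sum>i<N. norm (\<rho> i)) \<and>
        (\<forall>i<N. ((\<lambda>t. poly (critical_poly a N (\<lambda>j. x j + t * h j)) (x i + t * h i)) has_field_derivative - \<rho> i) (at 0))"
    if x: "x \<in> B" for x \<rho>
  proof -
    define R where "R = (\<Sum>i<N. norm (\<rho> i))"
    define h where "h j = (if j \<le> N then \<Sum>i<N. \<rho> i * c j i x else 0)" for j
    define Q where "Q = (\<Sum>i<N. smult (- \<rho> i / l i x) (L i x))"
    define D where "D = (\<Sum>j<N. smult (- h j) (L j x))"
    have hN: "h N = poly Q 0"
      by (simp add: h_def c_def Q_def poly_sum sum_negf[symmetric])
    have hj: "a * (- h j * l j x) = poly (pderiv Q) (x j)" if "j < N" for j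
    proof -
      have "a * (- h j * l j x) = (\<Sum>i<N. a * (- (\<rho> i * c j i x) * l j x))"
        using that by (simp add: h_def sum_distrib_left sum_distrib_right sum_negf)
      also have "\<dots> = (\<Sum>i<N. poly (smult (- \<rho> i / l i x) (pderiv (L i x))) (x j))"
        using that l0[OF x] \<open>a \<noteq> 0\<close> by (intro sum.cong) (auto simp: c_def)
      also have "\<dots> = poly (pderiv Q) (x j)"
        by (simp add: Q_def pderiv_sum pderiv_smult pderiv_minus poly_sum)
      finally show ?thesis .
    qed
    \<comment> \<open>For N > 0 both sides have degree below \<open>N\<close> and agree at the
      \<open>N\<close> distinct points \<open>x k\<close>.\<close>
    have "smult a D = pderiv Q"
    proof (cases "N = 0")
      case False
      show ?thesis
      proof (rule poly_eqI_roots[OF assms(3)[OF x]])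
        have "degree D \<le> N - 1"
          unfolding D_def by (intro degree_sum_le order_trans[OF degree_smult_le]) (auto simp: degL)
        then have "degree (smult a D) \<le> N - 1" using degree_smult_le[of a D] by linarith
        then show "degree (smult a D) < N" using False by linarith
        have "degree Q \<le> N - 1"
          unfolding Q_def by (intro degree_sum_le order_trans[OF degree_smult_le]) (auto simp: degL)
        then have "degree (pderiv Q) \<le> N - 1" by (simp add: degree_pderiv)
        then show "degree (pderiv Q) < N" using False by linarith
        fix k assume k: "k < N"
        have "poly D (x k) = (\<Sum>j<N. if j = k then - h k * l k x else 0)"
          unfolding D_def poly_sum using k by (intro sum.cong) (auto simp: LK)
        also have "\<dots> = - h k * l k x" using k by simp
        finally show "poly (smult a D) (x k) = poly (pderiv Q) (x k)"
          using hj[OF k] by simp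
      qed
    qed (simp add: D_def Q_def)
    then have AD: "smult a (poly_antideriv D) = Q - [:poly Q 0:]"
      by (metis poly_antideriv_smult poly_antideriv_pderiv)
    have "((\<lambda>t. poly (critical_poly a N (\<lambda>j. x j + t * h j)) (x i + t * h i)) has_field_derivative - \<rho> i) (at 0)"
      if "i < N" for i
    proof -
      have "poly Q (x i) = (\<Sum>j<N. if j = i then - \<rho> i else 0)"
        unfolding Q_def poly_sum using that l0[OF x] by (intro sum.cong) (auto simp: LK)
      then have "poly Q (x i) = - \<rho> i" using that by simp
      moreover have "a * poly (poly_antideriv D) (x i) = poly Q (x i) - poly Q 0"
        using arg_cong[OF AD, of "\<lambda>p. poly p (x i)"] by simp
      ultimately have "h N + a * poly (poly_antideriv D) (x i) = - \<rho> i" by (simp add: hN)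
      then show ?thesis
        using critical_value_has_derivative[OF that, of a x h] by (simp add: D_def L_def)
    qed
    moreover have "(\<Sum>j<Suc N. norm (h j)) \<le> C * R"
    proof -
      have "norm (h j) \<le> (\<Sum>i<N. \<bar>b i j\<bar>) * R" if "j < Suc N" for j
      proof -
        have "norm (h j) \<le> (\<Sum>i<N. norm (\<rho> i) * norm (c j i x))"
          using that unfolding h_def by (auto intro!: order_trans[OF norm_sum] simp: norm_mult)
        also have "\<dots> \<le> (\<Sum>i<N. R * \<bar>b i j\<bar>)"
        proof (intro sum_mono mult_mono)
          fix i assume i: "i \<in> {..<N}"
          show "norm (\<rho> i) \<le> R" unfolding R_def using i by (intro member_le_sum) auto
          show "norm (c j i x) \<le> \<bar>b i j\<bar>" using b[of i x j] x i by auto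
        qed (auto simp: R_def intro: sum_nonneg)
        finally show ?thesis by (simp add: sum_distrib_left mult.commute)
      qed
      then have "(\<Sum>j<Suc N. norm (h j)) \<le> (\<Sum>j<Suc N. (\<Sum>i<N. \<bar>b i j\<bar>) * R)" by (intro sum_mono) auto
      also have "\<dots> = (\<Sum>j<Suc N. \<Sum>i<N. \<bar>b i j\<bar>) * R" by (simp only: sum_distrib_right)
      also have "\<dots> \<le> C * R" unfolding C_def R_def by (intro mult_right_mono sum_nonneg) auto
      finally show ?thesis .
    qed
    moreover have "\<forall>j\<ge>Suc N. h j = 0" by (simp add: h_def)
    ultimately show ?thesis unfolding R_def by blast
  qed
  ultimately show thesis using that by blast
qed

lemma prescribed_critical_values:
  assumes "a \<noteq> 0" "inj_on x0 {..<N}" "r > 0"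
  obtains \<eta> where "\<eta> > 0"
    "\<And>y. (\<And>i. i < N \<Longrightarrow> norm (poly (critical_poly a N x0) (x0 i) - y i) < \<eta>) \<Longrightarrow>
        \<exists>x. (\<forall>j. norm (x j - x0 j) \<le> r) \<and> (\<forall>i<N. poly (critical_poly a N x) (x i) = y i)"
proof -
  obtain \<delta> where \<delta>: "\<delta> > 0" "\<And>i j. i < N \<Longrightarrow> j < N \<Longrightarrow> i \<noteq> j \<Longrightarrow> \<delta> \<le> dist (x0 i) (x0 j)"
    using finite_inj_separated[OF assms(2)] by blast
  \<comment> \<open>Points at least \<delta> apart stay distinct when each moves by at most \<delta>
    / 3.\<close>
  define r' where "r' = min r (\<delta> / 3)"
  have r': "r' > 0" "r' \<le> r" "3 * r' \<le> \<delta>" using \<delta> assms by (auto simp: r'_def)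
  define B where "B = {x. \<forall>j. x j \<in> (if j < Suc N then cball (x0 j) r' else {x0 j})}"
  have B: "norm (x j - x0 j) \<le> r'" if "x \<in> B" for x j
    using that r' by (auto simp: B_def dist_norm norm_minus_commute split: if_splits dest!: spec[of _ j])
  have inj: "inj_on x {..<N}" if "x \<in> B" for x
  proof (rule inj_onI, rule ccontr)
    fix i j assume ij: "i \<in> {..<N}" "j \<in> {..<N}" "x i = x j" "i \<noteq> j"
    have "\<delta> \<le> dist (x0 i) (x0 j)" using \<delta>(2) ij by auto
    also have "\<dots> \<le> dist (x0 i) (x i) + dist (x j) (x0 j)"
      using ij dist_triangle[of "x0 i" "x0 j" "x i"] by simp
    also have "\<dots> \<le> r' + r'"
      using B[OF that, of i] B[OF that, of j] by (intro add_mono) (auto simp: dist_norm norm_minus_commute)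
    finally show False using r' by linarith
  qed
  have "compact B" unfolding B_def by (rule compact_box_fun) auto
  then obtain C where C: "C > 0"
    "\<And>x \<rho>. x \<in> B \<Longrightarrow> \<exists>h. (\<forall>j\<ge>Suc N. h j = 0) \<and>
        (\<Sum>j<Suc N. norm (h j)) \<le> C * (\<Sum>i<N. norm (\<rho> i)) \<and>
        (\<forall>i<N. ((\<lambda>t. poly (critical_poly a N (\<lambda>j. x j + t * h j)) (x i + t * h i)) has_field_derivative - \<rho> i) (at 0))"
    using critical_values_directional_right_inverse[OF assms(1) _ inj] by blast
  have cont: "continuous_on B (\<lambda>x. poly (critical_poly a N x) (x i))" for i
    unfolding continuous_on_def
    by (intro ballI tendsto_critical_poly continuous_on_subset[OF continuous_on_product_coordinates subset_UNIV, unfolded continuous_on_def, rule_format])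
  \<comment> \<open>One more than the number of summands, so that the total error is strictly below
    \<open>M * \<eta>\<close>, also for N = 0.\<close>
  define M where "M = real N + 1"
  have M: "M > 0" by (simp add: M_def)
  define \<eta> where "\<eta> = r' / (2 * C * M)"
  have \<eta>: "\<eta> > 0" using r' C M by (simp add: \<eta>_def)
  moreover have "\<exists>x. (\<forall>j. norm (x j - x0 j) \<le> r) \<and> (\<forall>i<N. poly (critical_poly a N x) (x i) = y i)"
    if y: "\<And>i. i < N \<Longrightarrow> norm (poly (critical_poly a N x0) (x0 i) - y i) < \<eta>" for y
  proof -
    have "(\<Sum>i<N. norm (poly (critical_poly a N x0) (x0 i) - y i)) \<le> (\<Sum>i<N. \<eta>)"
      using y by (intro sum_mono) (auto intro: less_imp_le)
    also have "\<dots> < M * \<eta>" using \<eta> by (simp add: M_def)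
    also have "\<dots> = r' / (2 * C)" using M by (simp add: \<eta>_def)
    finally have "(\<Sum>i<N. norm (poly (critical_poly a N x0) (x0 i) - y i)) < r' / (2 * C)" .
    note lt = this
    have "\<exists>x\<in>B. \<forall>i<N. poly (critical_poly a N x) (x i) = y i"
      unfolding B_def
    proof (rule solvable_near_if_directional_right_inverse[OF r'(1) C(1),
          where F = "\<lambda>i x. poly (critical_poly a N x) (x i)"])
      show "continuous_on {x. \<forall>j. x j \<in> (if j < Suc N then cball (x0 j) r' else {x0 j})}
          (\<lambda>x. poly (critical_poly a N x) (x i))" for i
        using cont unfolding B_def .
    qed (rule C(2)[unfolded B_def] lt | assumption)+
    then show ?thesis using B r'(2) order_trans by blast
  qed
  ultimately show thesis using that by blast
qed

section \<open>Stars and Chebyshev polynomials\<close>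

lemma poly_root_near:
  fixes p :: "complex poly"
  assumes "degree p = d" "d > 0" "e > 0" "norm (poly p w - v) < norm (lead_coeff p) * e ^ d"
  shows "\<exists>z. poly p z = v \<and> norm (z - w) < e"
proof -
  define q where "q = p - [:v:]"
  have q: "degree q = d" "lead_coeff q = lead_coeff p"
  proof -
    have "q = p + [:- v:]" by (simp add: q_def)
    then show "degree q = d" using assms by (simp add: degree_add_eq_left)
    then show "lead_coeff q = lead_coeff p"
      using assms by (simp add: q_def coeff_pCons split: nat.split)
  qed
  obtain x where x: "q = smult (lead_coeff p) (root_poly {..<d} x)"
    using complex_poly_split[of q] q by auto
  have qw: "poly q z = lead_coeff p * (\<Prod>j<d. z - x j)" for z
    by (subst x) (simp add: poly_root_poly)
  \<comment> \<open>If all \<open>d\<close> roots of p - v were at distance at least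
    \<open>e\<close> from \<open>w\<close>, the factorisation would contradict the hypothesis. Only
    the degree and the leading coefficient of \<open>p\<close> enter.\<close>
  have "\<exists>j<d. norm (w - x j) < e"
  proof (rule ccontr)
    assume "\<not> (\<exists>j<d. norm (w - x j) < e)"
    then have "(\<Prod>j<d. e) \<le> (\<Prod>j<d. norm (w - x j))"
      using assms(3) by (intro prod_mono) auto
    then have "norm (lead_coeff p) * e ^ d \<le> norm (poly q w)"
      unfolding qw norm_mult by (intro mult_left_mono) (auto simp: prod_norm)
    then show False using assms(4) by (simp add: q_def)
  qed
  then obtain j where j: "j < d" "norm (w - x j) < e" by blast
  have "poly q (x j) = 0" unfolding qw using j(1) by auto
  then show ?thesis using j by (intro exI[of _ "x j"]) (auto simp: q_def norm_minus_commute)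
qed

text \<open>For norm z > 1 all lower terms together are at most S * norm z ^ N, so division by norm
  z ^ N leaves a linear bound on norm z.\<close>

lemma sublevel_set_bound:
  fixes p :: "complex poly"
  assumes "degree p \<le> Suc N" "coeff p (Suc N) \<noteq> 0" "(\<Sum>k\<le>N. norm (coeff p k)) \<le> S"
    and "norm (poly p z) \<le> 1"
  shows "norm z \<le> max 1 ((S + 1) / norm (coeff p (Suc N)))"
proof (cases "norm z \<le> 1")
  case False
  let ?c = "coeff p (Suc N)"
  have "poly p z = (\<Sum>k\<le>N. coeff p k * z ^ k) + ?c * z ^ Suc N"
    using poly_eq_sum_upto[OF assms(1)] by simp
  then have "norm ?c * norm z ^ Suc N = norm (poly p z - (\<Sum>k\<le>N. coeff p k * z ^ k))"
    by (simp add: norm_mult norm_power)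
  also have "\<dots> \<le> norm (poly p z) + norm (\<Sum>k\<le>N. coeff p k * z ^ k)" by (rule norm_triangle_ineq4)
  also have "\<dots> \<le> norm z ^ N + (\<Sum>k\<le>N. norm (coeff p k) * norm z ^ N)"
  proof (intro add_mono order_trans[OF norm_sum] sum_mono)
    show "norm (poly p z) \<le> norm z ^ N" using False assms(4) one_le_power[of "norm z" N] by linarith
    show "norm (coeff p k * z ^ k) \<le> norm (coeff p k) * norm z ^ N" if "k \<in> {..N}" for k
      using that False unfolding norm_mult norm_power by (intro mult_left_mono power_increasing) auto
  qed
  also have "\<dots> = (1 + (\<Sum>k\<le>N. norm (coeff p k))) * norm z ^ N"
    by (simp only: distrib_right sum_distrib_right mult_1)
  also have "\<dots> \<le> (1 + S) * norm z ^ N" using assms(3) by (intro mult_right_mono) auto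
  finally have "(norm ?c * norm z) * norm z ^ N \<le> (1 + S) * norm z ^ N" by (simp add: mult_ac)
  then have "norm ?c * norm z \<le> 1 + S"
    using False by (subst (asm) mult_le_cancel_right_pos) (auto intro!: zero_less_power)
  then show ?thesis using assms(2) by (simp add: field_simps le_max_iff_disj)
qed auto

text \<open>Exceptional points stay bounded because the leading coefficient is fixed, so a
  subsequence tends to some \<open>l\<close> with norm (poly p l) <= 1. Then \<open>l\<close> lies
  in the open set \<open>U\<close>, which those points avoid.\<close>

lemma eventually_sublevel_set_subset:
  fixes P :: "nat \<Rightarrow> complex poly"
  assumes lim: "\<And>k. (\<lambda>n. coeff (P n) k) \<longlonglongrightarrow> coeff p k"
    and deg: "\<And>n. degree (P n) \<le> Suc N" "degree p \<le> Suc N"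
    and lc: "\<And>n. coeff (P n) (Suc N) = c" "c \<noteq> 0"
    and U: "open U" "\<And>z. norm (poly p z) \<le> 1 \<Longrightarrow> z \<in> U"
  shows "eventually (\<lambda>n. \<forall>z. norm (poly (P n) z) \<le> 1 \<longrightarrow> z \<in> U) sequentially"
proof (rule ccontr)
  assume "\<not> ?thesis"
  then have "\<forall>m. \<exists>n. n \<ge> m \<and> (\<exists>z. norm (poly (P n) z) \<le> 1 \<and> z \<notin> U)"
    unfolding eventually_sequentially by blast
  then obtain f where f: "\<And>m. f m \<ge> m" "\<forall>m. \<exists>z. norm (poly (P (f m)) z) \<le> 1 \<and> z \<notin> U"
    by (elim choice[THEN exE]) blast
  from f(2) obtain z where z: "\<And>m. norm (poly (P (f m)) (z m)) \<le> 1" "\<And>m. z m \<notin> U"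
    by (elim choice[THEN exE]) blast
  have ft: "filterlim f at_top sequentially"
    using f(1) by (intro filterlim_at_top_mono[OF filterlim_ident]) auto
  have "(\<lambda>n. \<Sum>k\<le>N. norm (coeff (P n) k)) \<longlonglongrightarrow> (\<Sum>k\<le>N. norm (coeff p k))"
    by (intro tendsto_intros lim)
  then have "Bseq (\<lambda>n. \<Sum>k\<le>N. norm (coeff (P n) k))"
    by (intro convergent_imp_Bseq convergentI)
  then obtain S where "\<forall>n. norm (\<Sum>k\<le>N. norm (coeff (P n) k)) \<le> S" by (rule BseqE)
  then have S: "(\<Sum>k\<le>N. norm (coeff (P n) k)) \<le> S" for n by (auto dest!: spec[of _ n])
  define R where "R = max 1 ((S + 1) / norm c)"
  have "\<forall>m. z m \<in> cball 0 R"
  proof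
    fix m
    have "norm (z m) \<le> max 1 ((S + 1) / norm (coeff (P (f m)) (Suc N)))"
      by (rule sublevel_set_bound[OF deg(1) _ S z(1)]) (simp add: lc)
    then show "z m \<in> cball 0 R" by (simp add: R_def lc(1))
  qed
  then obtain l r where l: "strict_mono r" "(z \<circ> r) \<longlonglongrightarrow> l"
    using compact_cball[of "0::complex" R] unfolding compact_def by blast
  have fr: "filterlim (\<lambda>m. f (r m)) at_top sequentially"
    using filterlim_compose[OF ft filterlim_subseq[OF l(1)]] .
  have "(\<lambda>m. poly (P (f (r m))) ((z \<circ> r) m)) \<longlonglongrightarrow> poly p l"
    by (intro tendsto_poly_family[where n = "Suc N"] filterlim_compose[OF lim fr] deg l(2))
  then have "(\<lambda>m. norm (poly (P (f (r m))) ((z \<circ> r) m))) \<longlonglongrightarrow> norm (poly p l)"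
    by (rule tendsto_norm)
  then have "norm (poly p l) \<le> 1"
    by (rule LIMSEQ_le_const2) (use z(1) in auto)
  then have "l \<in> U" by (rule U(2))
  then have "eventually (\<lambda>m. (z \<circ> r) m \<in> U) sequentially"
    using l(2) U(1) by (rule topological_tendstoD[rotated 2])
  then show False using z(2) by simp
qed

text \<open>Each of the three conditions eventually holds along every sequence of parameters tending
  to \<open>x0\<close>, so counterexamples cannot exist for every radius 1 / (n + 1).\<close>

lemma critical_poly_perturbation:
  assumes "a \<noteq> 0" "open U" "finite F"
    and U: "\<And>z. norm (poly (critical_poly a N x0) z) \<le> 1 \<Longrightarrow> z \<in> U"
    and F: "\<And>w. w \<in> F \<Longrightarrow> norm (poly (critical_poly a N x0) w) < 1"
    and C: "\<And>i. i < N \<Longrightarrow> norm (poly (critical_poly a N x0) (x0 i)) < 1"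
  obtains r where "r > 0" "\<And>x. (\<And>j. norm (x j - x0 j) \<le> r) \<Longrightarrow>
    (\<forall>z. norm (poly (critical_poly a N x) z) \<le> 1 \<longrightarrow> z \<in> U) \<and>
    (\<forall>w\<in>F. norm (poly (critical_poly a N x) w) < 1) \<and>
    (\<forall>i<N. norm (poly (critical_poly a N x) (x i)) < 1)"
proof -
  define G where "G x \<longleftrightarrow> (\<forall>z. norm (poly (critical_poly a N x) z) \<le> 1 \<longrightarrow> z \<in> U) \<and>
    (\<forall>w\<in>F. norm (poly (critical_poly a N x) w) < 1) \<and>
    (\<forall>i<N. norm (poly (critical_poly a N x) (x i)) < 1)" for x
  have "\<exists>r>0. \<forall>x. (\<forall>j. norm (x j - x0 j) \<le> r) \<longrightarrow> G x"
  proof (rule ccontr)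
    assume "\<not> ?thesis"
    then have "\<forall>n. \<exists>x. (\<forall>j. norm (x j - x0 j) \<le> 1 / real (Suc n)) \<and> \<not> G x"
      by (metis of_nat_0_less_iff zero_less_Suc zero_less_divide_1_iff)
    then obtain X where X: "\<And>n j. norm (X n j - x0 j) \<le> 1 / real (Suc n)" "\<And>n. \<not> G (X n)"
      by (elim choice[THEN exE]) blast
    have lim: "(\<lambda>n. X n j) \<longlonglongrightarrow> x0 j" for j
    proof (rule LIM_zero_cancel)
      show "(\<lambda>n. X n j - x0 j) \<longlonglongrightarrow> 0"
      proof (rule Lim_null_comparison[OF always_eventually[OF allI]])
        show "norm (X n j - x0 j) \<le> inverse (real (Suc n))" for n
          using X(1)[of n j] by (simp only: inverse_eq_divide)
      qed (rule LIMSEQ_inverse_real_of_nat)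
    qed
    have ne: "a / of_nat (Suc N) \<noteq> 0"
      using \<open>a \<noteq> 0\<close> by (simp del: of_nat_Suc)
    have "eventually (\<lambda>n. \<forall>z. norm (poly (critical_poly a N (X n)) z) \<le> 1 \<longrightarrow> z \<in> U) sequentially"
    proof (rule eventually_sublevel_set_subset[where P = "\<lambda>n. critical_poly a N (X n)"
          and p = "critical_poly a N x0" and N = N and c = "a / of_nat (Suc N)"])
      show "(\<lambda>n. coeff (critical_poly a N (X n)) k) \<longlonglongrightarrow> coeff (critical_poly a N x0) k" for k
        by (rule tendsto_coeff_critical_poly) (rule lim)
    qed (rule ne \<open>open U\<close> degree_critical_poly_le coeff_critical_poly_Suc U | assumption)+
    moreover have "eventually (\<lambda>n. \<forall>w\<in>F. norm (poly (critical_poly a N (X n)) w) < 1) sequentially"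
    proof (intro eventually_ball_finite \<open>finite F\<close> ballI)
      fix w assume "w \<in> F"
      have "(\<lambda>n. norm (poly (critical_poly a N (X n)) w)) \<longlonglongrightarrow> norm (poly (critical_poly a N x0) w)"
        by (intro tendsto_norm tendsto_critical_poly lim tendsto_const)
      then show "eventually (\<lambda>n. norm (poly (critical_poly a N (X n)) w) < 1) sequentially"
        using F[OF \<open>w \<in> F\<close>] by (rule order_tendstoD)
    qed
    moreover have "eventually (\<lambda>n. \<forall>i\<in>{..<N}. norm (poly (critical_poly a N (X n)) (X n i)) < 1) sequentially"
    proof (intro eventually_ball_finite ballI)
      fix i assume i: "i \<in> {..<N}"
      have "(\<lambda>n. norm (poly (critical_poly a N (X n)) (X n i))) \<longlonglongrightarrow> norm (poly (critical_poly a N x0) (x0 i))"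
        by (intro tendsto_norm tendsto_critical_poly lim)
      then show "eventually (\<lambda>n. norm (poly (critical_poly a N (X n)) (X n i)) < 1) sequentially"
        using C[of i] i by (intro order_tendstoD) auto
    qed simp
    ultimately have "eventually (\<lambda>n. G (X n)) sequentially"
      unfolding G_def by eventually_elim auto
    then show False using X(2) by simp
  qed
  then show thesis using that unfolding G_def by blast
qed

lemma inj_perturbation:
  fixes x :: "nat \<Rightarrow> complex"
  assumes "r > 0"
  obtains x' where "inj_on x' {..<N}" "\<And>j. norm (x' j - x j) \<le> r"
proof -
  \<comment> \<open>The perturbation adds \<tau> * j to \<open>x j\<close>; two points can then
    coincide only if the real number \<tau> is one of these finitely many values.\<close>
  define B where "B = (\<lambda>(i, j). Re ((x j - x i) / (of_nat i - of_nat j))) ` ({..<N} \<times> {..<N})"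
  have "finite B" unfolding B_def by simp
  moreover have "infinite {0<..<r / (real N + 1)}" using assms by (simp add: infinite_Ioo)
  ultimately have "\<not> {0<..<r / (real N + 1)} \<subseteq> B" using finite_subset by blast
  then obtain \<tau> where "\<tau> \<in> {0<..<r / (real N + 1)}" "\<tau> \<notin> B" by blast
  then have \<tau>: "0 < \<tau>" "\<tau> < r / (real N + 1)" "\<tau> \<notin> B" by auto
  define x' where "x' j = (if j < N then x j + of_real \<tau> * of_nat j else x j)" for j
  have "inj_on x' {..<N}"
  proof (rule inj_onI, rule ccontr)
    fix i j assume ij: "i \<in> {..<N}" "j \<in> {..<N}" "x' i = x' j" "i \<noteq> j"
    then have "of_real \<tau> * (of_nat i - of_nat j) = x j - x i" by (simp add: x'_def algebra_simps)
    moreover have "(of_nat i - of_nat j :: complex) \<noteq> 0" using ij by simp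
    ultimately have "of_real \<tau> = (x j - x i) / (of_nat i - of_nat j)" by (simp add: field_simps)
    then have "\<tau> = Re ((x j - x i) / (of_nat i - of_nat j))" by (metis Re_complex_of_real)
    then have "\<tau> \<in> B" unfolding B_def using ij by (intro image_eqI[of _ _ "(i, j)"]) auto
    then show False using \<tau> by simp
  qed
  moreover have "norm (x' j - x j) \<le> r" for j
  proof (cases "j < N")
    case True
    have "norm (x' j - x j) = \<tau> * real j" using True \<tau> by (simp add: x'_def norm_mult)
    also have "\<dots> \<le> \<tau> * (real N + 1)" using True \<tau> by (intro mult_left_mono) auto
    also have "\<dots> \<le> r" using \<tau> by (simp add: field_simps)
    finally show ?thesis .
  qed (use assms in \<open>simp add: x'_def\<close>)
  ultimately show thesis using that by blast
qed

text \<open>The Chebyshev polynomial of degree \<open>2 ^ k\<close>.\<close>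

primrec cheb :: "nat \<Rightarrow> complex poly" where
  "cheb 0 = [:0, 1:]"
| "cheb (Suc k) = [:-1, 0, 2:] \<circ>\<^sub>p cheb k"

lemma poly_cheb_Suc: "poly (cheb (Suc k)) z = 2 * (poly (cheb k) z)\<^sup>2 - 1"
  by (simp add: poly_pcompose power2_eq_square)

lemma poly_pderiv_cheb_Suc:
  "poly (pderiv (cheb (Suc k))) z = 4 * poly (cheb k) z * poly (pderiv (cheb k)) z"
  by (simp add: pderiv_pcompose poly_pcompose pderiv_pCons)

lemma poly_cheb_cos: "poly (cheb k) (of_real (cos \<theta>)) = of_real (cos (2 ^ k * \<theta>))"
proof (induction k)
  case (Suc k)
  have "cos (2 ^ Suc k * \<theta>) = 2 * (cos (2 ^ k * \<theta>))\<^sup>2 - 1"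
    using cos_double_cos[of "2 ^ k * \<theta>"] by (simp add: mult_ac)
  then show ?case by (simp only: poly_cheb_Suc Suc) simp
qed simp

lemma cheb_pm1: "z \<in> {-1, 1} \<Longrightarrow> poly (cheb k) z \<in> {-1, 1}"
  by (induction k) (auto simp: poly_cheb_Suc simp del: cheb.simps(2))

text \<open>By the chain rule a critical point is a zero of the previous polynomial, with value -1,
  or a critical point of it, where the previous value -1 or 1 goes to 1.\<close>

lemma cheb_critical: "poly (pderiv (cheb k)) z = 0 \<Longrightarrow> poly (cheb k) z \<in> {-1, 1}"
proof (induction k)
  case (Suc k)
  then show ?case by (auto simp: poly_cheb_Suc poly_pderiv_cheb_Suc simp del: cheb.simps(2))
qed (simp add: pderiv_pCons)

lemma double_square_in_interval_iff:
  fixes u :: complex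
  shows "2 * u\<^sup>2 - 1 \<in> of_real ` {-1..1} \<longleftrightarrow> u \<in> of_real ` {-1..1}"
proof
  assume "u \<in> of_real ` {-1..1}"
  then obtain t where t: "u = of_real t" "-1 \<le> t" "t \<le> 1" by auto
  have "t\<^sup>2 \<le> 1" using t by (simp add: abs_square_le_1 abs_le_iff)
  then show "2 * u\<^sup>2 - 1 \<in> of_real ` {-1..1}"
    using t by (intro image_eqI[of _ _ "2 * t\<^sup>2 - 1"]) auto
next
  assume "2 * u\<^sup>2 - 1 \<in> of_real ` {-1..1}"
  then obtain t where t: "2 * u\<^sup>2 - 1 = of_real t" "-1 \<le> t" "t \<le> 1" by auto
  define s where "s = sqrt ((t + 1) / 2)"
  have s: "0 \<le> s" "s \<le> 1" "s\<^sup>2 = (t + 1) / 2" using t by (auto simp: s_def)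
  have "u\<^sup>2 = of_real (s\<^sup>2)" using t(1) by (simp add: s(3) field_simps)
  then have "u\<^sup>2 = (of_real s)\<^sup>2" by simp
  then have "u = of_real s \<or> u = of_real (- s)" by (simp add: power2_eq_iff)
  then show "u \<in> of_real ` {-1..1}" using s by (auto intro: image_eqI[of _ _ s] image_eqI[of _ _ "- s"])
qed

text \<open>Composition with \<open>cheb k\<close> leaves the preimage of [-1, 1] unchanged, so
  \<open>k\<close> may be as large as the critical values require.\<close>

lemma cheb_in_interval_iff:
  "poly (cheb k) z \<in> of_real ` {-1..1} \<longleftrightarrow> z \<in> of_real ` {-1..1}"
  by (induction k) (simp_all only: poly_cheb_Suc double_square_in_interval_iff, simp)

section \<open>Density of the star and of its vertices\<close>

lemma norm_cis_diff_le: "norm (cis \<alpha> - cis \<beta>) \<le> \<bar>\<alpha> - \<beta>\<bar>"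
proof -
  define t where "t = \<alpha> - \<beta>"
  have "(norm (cis t - 1))\<^sup>2 = (cos t - 1)\<^sup>2 + (sin t)\<^sup>2" by (simp add: cmod_power2)
  also have "\<dots> = 2 - 2 * cos t" using sin_cos_squared_add[of t] by (simp add: power2_eq_square algebra_simps)
  also have "\<dots> = (2 * sin (t / 2))\<^sup>2" using cos_double_sin[of "t / 2"] by (simp add: power_mult_distrib)
  finally have "norm (cis t - 1) = \<bar>2 * sin (t / 2)\<bar>"
    by (metis abs_norm_cancel power2_eq_iff_nonneg abs_ge_zero norm_ge_zero power2_abs)
  also have "\<dots> \<le> \<bar>t\<bar>" using abs_sin_x_le_abs_x[of "t / 2"] by (simp add: abs_mult)
  finally have "norm (cis t - 1) \<le> \<bar>t\<bar>" .
  moreover have "cis \<alpha> - cis \<beta> = cis \<beta> * (cis t - 1)" by (simp add: t_def algebra_simps cis_mult)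
  ultimately show ?thesis by (simp add: norm_mult t_def)
qed

text \<open>The preimage of \<open>[-1, 1]\<close> under \<open>2 * v ^ n - 1\<close> is a star of \<open>n\<close> equally spaced radii of
  the unit disk, hence almost dense in the disk.\<close>

lemma star_dense:
  assumes "norm w \<le> 1" "n > 0"
  obtains \<alpha> where "cis \<alpha> ^ n = 1" "norm (w - of_real (norm w) * cis \<alpha>) \<le> 2 * pi / real n"
proof -
  define \<theta> where "\<theta> = Arg w"
  \<comment> \<open>The argument of \<open>w\<close> is rounded down to a multiple of 2 * pi / n,
    and \<open>w\<close> is turned onto that radius with its modulus unchanged.\<close>
  define j where "j = \<lfloor>\<theta> * real n / (2 * pi)\<rfloor>"
  define \<alpha> where "\<alpha> = 2 * pi * of_int j / real n"
  have "cis \<alpha> ^ n = cis (2 * pi * of_int j)" using assms by (simp add: Complex.DeMoivre \<alpha>_def)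
  then have "cis \<alpha> ^ n = 1" by (simp add: cis_multiple_2pi)
  moreover have "norm (w - of_real (norm w) * cis \<alpha>) \<le> 2 * pi / real n"
  proof -
    have w: "w = of_real (norm w) * cis \<theta>"
      using rcis_cmod_Arg[of w] by (simp add: rcis_def \<theta>_def)
    have "\<bar>\<theta> * real n / (2 * pi) - of_int j\<bar> \<le> 1" unfolding j_def by linarith
    moreover have "\<theta> - \<alpha> = (\<theta> * real n / (2 * pi) - of_int j) * (2 * pi / real n)"
      using assms by (simp add: \<alpha>_def field_simps)
    then have "\<bar>\<theta> - \<alpha>\<bar> = \<bar>\<theta> * real n / (2 * pi) - of_int j\<bar> * (2 * pi / real n)"
      by (simp only: abs_mult) simp
    ultimately have "\<bar>\<theta> - \<alpha>\<bar> \<le> 1 * (2 * pi / real n)"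
      by (simp only:) (intro mult_right_mono, auto)
    then have le: "norm (cis \<theta> - cis \<alpha>) \<le> 2 * pi / real n"
      using norm_cis_diff_le[of \<theta> \<alpha>] by linarith
    have "w - of_real (norm w) * cis \<alpha> = of_real (norm w) * (cis \<theta> - cis \<alpha>)"
      by (subst (1) w) (simp add: algebra_simps)
    then have "norm (w - of_real (norm w) * cis \<alpha>) = norm w * norm (cis \<theta> - cis \<alpha>)"
      by (simp add: norm_mult)
    also have "\<dots> \<le> 1 * (2 * pi / real n)" using assms le by (intro mult_mono) auto
    finally show ?thesis by simp
  qed
  ultimately show thesis using that by blast
qed

text \<open>On the star, 2 * v ^ n - 1 is the cosine of an angle, and \<open>cheb k\<close>
  multiplies the angle by 2 ^ k. So points whose angle is a multiple of pi / 2 ^ k go to -1 or 1,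
  and by continuity of \<open>root n\<close> they fill the radius as \<open>k\<close> grows. The
  form with \<open>eventually\<close> lets one \<open>k\<close> serve finitely many
  \<open>w\<close>.\<close>

lemma star_vertices_dense:
  assumes "norm w \<le> 1" "n > 0" "\<eta> > 0"
  shows "eventually (\<lambda>k. \<exists>v. norm (w - v) < 2 * pi / real n + \<eta> \<and>
           poly (cheb k) (2 * v ^ n - 1) \<in> {-1, 1}) sequentially"
proof -
  obtain \<alpha> where \<alpha>: "cis \<alpha> ^ n = 1" "norm (w - of_real (norm w) * cis \<alpha>) \<le> 2 * pi / real n"
    using star_dense[OF assms(1,2)] by blast
  define y where "y = 2 * norm w ^ n - 1"
  have y: "-1 \<le> y" "y \<le> 1" using assms power_le_one[of "norm w" n] by (auto simp: y_def)
  define \<theta> where "\<theta> = arccos y"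
  have cos\<theta>: "cos \<theta> = y" using y by (simp add: \<theta>_def)
  define m where "m k = \<lfloor>2 ^ k * \<theta> / pi\<rfloor>" for k :: nat
  define \<theta>' where "\<theta>' k = of_int (m k) * pi / 2 ^ k" for k
  have "(\<lambda>k. \<theta>' k - \<theta>) \<longlonglongrightarrow> 0"
  proof (rule Lim_null_comparison)
    show "eventually (\<lambda>k. norm (\<theta>' k - \<theta>) \<le> pi * (1 / 2) ^ k) sequentially"
    proof (rule always_eventually, rule allI)
      fix k
      have "\<bar>of_int (m k) - 2 ^ k * \<theta> / pi\<bar> \<le> 1" unfolding m_def by linarith
      moreover have "\<theta>' k - \<theta> = (of_int (m k) - 2 ^ k * \<theta> / pi) * (pi / 2 ^ k)"
        by (simp add: \<theta>'_def field_simps)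
      then have "\<bar>\<theta>' k - \<theta>\<bar> = \<bar>of_int (m k) - 2 ^ k * \<theta> / pi\<bar> * (pi / 2 ^ k)"
        by (simp only: abs_mult) simp
      ultimately have "\<bar>\<theta>' k - \<theta>\<bar> \<le> 1 * (pi / 2 ^ k)"
        by (simp only:) (intro mult_right_mono, auto)
      then show "norm (\<theta>' k - \<theta>) \<le> pi * (1 / 2) ^ k" by (simp add: power_divide)
    qed
    show "(\<lambda>k. pi * (1 / 2) ^ k) \<longlonglongrightarrow> 0"
      by (intro tendsto_mult_right_zero LIMSEQ_power_zero) simp
  qed
  then have lim: "\<theta>' \<longlonglongrightarrow> \<theta>" by (rule LIM_zero_cancel)
  define v where "v k = of_real (root n ((1 + cos (\<theta>' k)) / 2)) * cis \<alpha>" for k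
  have "root n ((1 + cos \<theta>) / 2) = norm w"
    using assms(2) by (simp add: cos\<theta> y_def real_root_power_cancel)
  moreover have "v \<longlonglongrightarrow> of_real (root n ((1 + cos \<theta>) / 2)) * cis \<alpha>"
    unfolding v_def by (intro tendsto_intros tendsto_real_root lim) auto
  ultimately have "v \<longlonglongrightarrow> of_real (norm w) * cis \<alpha>" by simp
  then have "eventually (\<lambda>k. dist (v k) (of_real (norm w) * cis \<alpha>) < \<eta>) sequentially"
    using assms(3) by (rule tendstoD)
  then show ?thesis
  proof eventually_elim
    case (elim k)
    have "norm (w - v k) \<le> norm (w - of_real (norm w) * cis \<alpha>) + dist (v k) (of_real (norm w) * cis \<alpha>)"
      using dist_triangle2[of w "v k" "of_real (norm w) * cis \<alpha>"] by (simp add: dist_norm)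
    then have "norm (w - v k) < 2 * pi / real n + \<eta>" using \<alpha>(2) elim by linarith
    moreover have "2 * v k ^ n - 1 = of_real (cos (\<theta>' k))"
    proof -
      have "0 \<le> (1 + cos (\<theta>' k)) / 2" by (simp add: real_0_le_add_iff)
      then have "root n ((1 + cos (\<theta>' k)) / 2) ^ n = (1 + cos (\<theta>' k)) / 2"
        using assms(2) by (intro real_root_pow_pos2) auto
      then have "v k ^ n = of_real ((1 + cos (\<theta>' k)) / 2)"
        unfolding v_def power_mult_distrib \<alpha>(1) by (metis mult.right_neutral of_real_power)
      then have "2 * v k ^ n - 1 = of_real (2 * ((1 + cos (\<theta>' k)) / 2) - 1)"
        by (simp only: of_real_diff of_real_mult of_real_numeral of_real_1)
      also have "2 * ((1 + cos (\<theta>' k)) / 2) - 1 = cos (\<theta>' k)" by (simp add: field_simps)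
      finally show ?thesis .
    qed
    then have val: "poly (cheb k) (2 * v k ^ n - 1) = of_real (cos (2 ^ k * \<theta>' k))"
      by (simp only: poly_cheb_cos)
    have "2 ^ k * \<theta>' k = pi * of_int (m k)" by (simp add: \<theta>'_def)
    then have "poly (cheb k) (2 * v k ^ n - 1) \<in> {-1, 1}"
      unfolding val by (simp add: cos_npi_int)
    ultimately show ?case by blast
  qed
qed

text \<open>Besides the critical points of \<open>cheb k\<close> and of \<open>q\<close> there are,
  for n > 1, the zeros of \<open>q\<close>, where the inner polynomial is -1, which
  \<open>cheb k\<close> sends to -1 or 1. Both values occur once k >= 2: where the inner polynomial
  is a zero of \<open>cheb (k - 1)\<close> the value is -1, at a zero of \<open>cheb (k - 2)\<close>
  it is 1.\<close>

lemma critical_values_cheb_comp: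
  assumes "degree q > 0" and crit: "\<And>c. poly (pderiv q) c = 0 \<Longrightarrow> poly (cheb k) (2 * poly q c ^ n - 1) \<in> {-1, 1}"
    and "n > 0" "k \<ge> 2"
  shows "critical_values (cheb k \<circ>\<^sub>p ([:-1:] + smult 2 (q ^ n))) = {-1, 1}"
proof -
  define g where "g = [:-1:] + smult 2 (q ^ n)"
  have g: "poly g z = 2 * poly q z ^ n - 1" for z by (simp add: g_def)
  have dg: "poly (pderiv g) z = 2 * (of_nat n * poly q z ^ (n - 1) * poly (pderiv q) z)" for z
    using \<open>n > 0\<close>
    by (cases n) (simp_all add: g_def pderiv_add pderiv_smult pderiv_power_Suc pderiv_pCons del: power_Suc)
  have dP: "poly (pderiv (cheb k \<circ>\<^sub>p g)) z = poly (pderiv (cheb k)) (poly g z) * poly (pderiv g) z" for z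
    by (simp add: pderiv_pcompose poly_pcompose)
  have "critical_values (cheb k \<circ>\<^sub>p g) \<subseteq> {-1, 1}"
  proof
    fix y assume "y \<in> critical_values (cheb k \<circ>\<^sub>p g)"
    then obtain c where c: "y = poly (cheb k) (poly g c)"
        "poly (pderiv (cheb k)) (poly g c) = 0 \<or> poly (pderiv g) c = 0"
      by (auto simp: critical_values_def dP poly_pcompose)
    show "y \<in> {-1, 1}"
    proof (cases "poly (pderiv (cheb k)) (poly g c) = 0")
      case True
      then show ?thesis using cheb_critical c(1) by blast
    next
      case False
      then have "poly q c ^ (n - 1) = 0 \<or> poly (pderiv q) c = 0"
        using c(2) \<open>n > 0\<close> by (auto simp: dg)
      then show ?thesis
      proof
        assume "poly q c ^ (n - 1) = 0"
        then have "poly g c = -1" using \<open>n > 0\<close> by (simp add: g)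
        then show ?thesis using cheb_pm1[of "-1" k] c(1) by simp
      next
        assume "poly (pderiv q) c = 0"
        then show ?thesis using crit c(1) g by simp
      qed
    qed
  qed
  moreover have "poly (cheb k) (poly g z) \<in> critical_values (cheb k \<circ>\<^sub>p g)"
    if "poly (pderiv (cheb k)) (poly g z) = 0" for z
    unfolding critical_values_def mem_Collect_eq
    by (rule exI[of _ z]) (simp add: dP that poly_pcompose)
  moreover have surj: "\<exists>z. poly (cheb i) (poly g z) = 0" for i
  proof -
    have "poly (cheb i) (of_real (cos (pi / 2 / 2 ^ i))) = 0"
      unfolding poly_cheb_cos by simp
    moreover have "\<exists>z. poly g z = w" for w
    proof -
      have "q \<noteq> 0" using assms(1) by auto
      then have d: "degree (smult 2 (q ^ n)) > 0" using assms(1,3) by (simp add: degree_power_eq)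
      have "degree ([:- 1 - w:] + smult 2 (q ^ n)) = degree (smult 2 (q ^ n))"
        by (rule degree_add_eq_right) (use d in simp)
      then have "degree ([:- 1 - w:] + smult 2 (q ^ n)) > 0" using d by (simp only:)
      then have "\<not> constant (poly ([:- 1 - w:] + smult 2 (q ^ n)))" by (simp add: constant_degree)
      then obtain z where "poly ([:- 1 - w:] + smult 2 (q ^ n)) z = 0"
        using Fundamental_Theorem_Algebra.fundamental_theorem_of_algebra by blast
      then show ?thesis by (intro exI[of _ z]) (simp add: g algebra_simps)
    qed
    ultimately show ?thesis by metis
  qed
  moreover obtain k' where k: "k = Suc (Suc k')" using \<open>k \<ge> 2\<close> by (metis add_2_eq_Suc le_Suc_ex)
  moreover have "-1 \<in> critical_values (cheb k \<circ>\<^sub>p g)"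
  proof -
    obtain z where z: "poly (cheb (Suc k')) (poly g z) = 0" using surj by blast
    then show ?thesis
      using calculation(2)[of z] unfolding k
      by (simp add: poly_pderiv_cheb_Suc poly_cheb_Suc del: cheb.simps(2))
  qed
  moreover have "1 \<in> critical_values (cheb k \<circ>\<^sub>p g)"
  proof -
    obtain z where z: "poly (cheb k') (poly g z) = 0" using surj by blast
    then show ?thesis
      using calculation(2)[of z] unfolding k
      by (simp add: poly_pderiv_cheb_Suc poly_cheb_Suc del: cheb.simps(2))
  qed
  ultimately show ?thesis unfolding g_def by blast
qed

section \<open>Hausdorff distance and assembly\<close>

lemma hausdorff_dist_le:
  assumes "e > 0" "A \<subseteq> nbhd B e" "B \<subseteq> nbhd A e"
  shows "hausdorff_dist A B \<le> e"
  unfolding hausdorff_dist_def using assms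
  by (intro cInf_lower bdd_belowI[of _ 0]) auto

lemma star_tree_exists:
  fixes p :: "complex poly" and U :: "complex set"
  assumes "degree p > 0" "open U" "finite F" "e > 0"
    and U: "\<And>z. norm (poly p z) \<le> 1 \<Longrightarrow> z \<in> U"
    and F: "\<And>w. w \<in> F \<Longrightarrow> norm (poly p w) < 1"
    and C: "\<And>c. poly (pderiv p) c = 0 \<Longrightarrow> norm (poly p c) < 1"
  obtains n k q where "n > 0" "k \<ge> 2" "degree q > 0"
    "\<And>c. poly (pderiv q) c = 0 \<Longrightarrow> poly (cheb k) (2 * poly q c ^ n - 1) \<in> {-1, 1}"
    "\<And>z. norm (poly q z) \<le> 1 \<Longrightarrow> z \<in> U"
    "\<And>w. w \<in> F \<Longrightarrow> \<exists>z. norm (z - w) < e \<and> poly q z ^ n \<in> of_real ` {0..1}"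
proof -
  obtain N where N: "degree p = Suc N" using assms(1) by (metis not0_implies_Suc less_not_refl)
  obtain a x0 where a: "a \<noteq> 0" and p: "p = critical_poly a N x0"
    using critical_poly_exists[OF N] by blast
  have "norm (poly (critical_poly a N x0) (x0 i)) < 1" if "i < N" for i
  proof -
    have "poly (pderiv p) (x0 i) = 0"
      using that by (auto simp: p pderiv_critical_poly poly_root_poly)
    then show ?thesis using C p by simp
  qed
  then obtain r where r: "r > 0" and good: "\<And>x. (\<And>j. norm (x j - x0 j) \<le> r) \<Longrightarrow>
    (\<forall>z. norm (poly (critical_poly a N x) z) \<le> 1 \<longrightarrow> z \<in> U) \<and>
    (\<forall>w\<in>F. norm (poly (critical_poly a N x) w) < 1) \<and>
    (\<forall>i<N. norm (poly (critical_poly a N x) (x i)) < 1)"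
    using critical_poly_perturbation[OF a \<open>open U\<close> \<open>finite F\<close>, of N x0] U F unfolding p by metis
  \<comment> \<open>Half of the radius is spent on separating the critical points, half on moving
    the critical values.\<close>
  obtain x1 where x1: "inj_on x1 {..<N}" "\<And>j. norm (x1 j - x0 j) \<le> r / 2"
    using inj_perturbation[of "r / 2" N x0] r by auto
  have "norm (x1 j - x0 j) \<le> r" for j using x1(2)[of j] r by linarith
  then have x1C: "norm (poly (critical_poly a N x1) (x1 i)) < 1" if "i < N" for i
    using good[of x1] that by blast
  obtain \<eta> where \<eta>: "\<eta> > 0"
    "\<And>y. (\<And>i. i < N \<Longrightarrow> norm (poly (critical_poly a N x1) (x1 i) - y i) < \<eta>) \<Longrightarrow>
        \<exists>x. (\<forall>j. norm (x j - x1 j) \<le> r / 2) \<and> (\<forall>i<N. poly (critical_poly a N x) (x i) = y i)"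
    using prescribed_critical_values[OF a x1(1), of "r / 2"] r by auto
  \<comment> \<open>The threshold of \<open>poly_root_near\<close> for every polynomial of this
    degree and leading coefficient; it is known before \<open>q\<close> is, so \<open>n\<close> can
    be chosen by it.\<close>
  define \<eta>2 where "\<eta>2 = norm (a / of_nat (Suc N)) * e ^ Suc N"
  have "\<eta>2 > 0" using a \<open>e > 0\<close> unfolding \<eta>2_def by (simp del: of_nat_Suc)
  \<comment> \<open>Once 2 * pi / n < h, vertices come within 2 * h <= \<eta> of the critical
    values, and the radii come within \<eta>2 of every point of the disk.\<close>
  define h where "h = min \<eta> \<eta>2 / 2"
  have h: "h > 0" "h < \<eta>" "2 * h \<le> \<eta>" "h < \<eta>2" using \<eta>(1) \<open>\<eta>2 > 0\<close> unfolding h_def by auto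
  obtain n where n: "n > 0" "2 * pi / real n < h"
  proof -
    obtain n where "2 * pi / h < real n" using reals_Archimedean2 by blast
    moreover have "2 * pi / h > 0" using h by simp
    ultimately have "real n > 0" by linarith
    then show thesis using that[of n] \<open>2 * pi / h < real n\<close> h by (simp add: field_simps)
  qed
  have "eventually (\<lambda>k. k \<ge> 2 \<and> (\<forall>i\<in>{..<N}. \<exists>v. norm (poly (critical_poly a N x1) (x1 i) - v) < 2 * pi / real n + h \<and>
           poly (cheb k) (2 * v ^ n - 1) \<in> {-1, 1})) sequentially"
    using n h x1C
    by (intro eventually_conj eventually_ge_at_top eventually_ball_finite ballI star_vertices_dense)
       (auto intro: less_imp_le)
  from eventually_happens'[OF sequentially_bot this]
  \<comment> \<open>The condition on \<open>i\<close> stands inside the existential so that choice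
    yields a total function \<open>y\<close>.\<close>
  obtain k where k: "k \<ge> 2" "\<forall>i. \<exists>v. i < N \<longrightarrow> norm (poly (critical_poly a N x1) (x1 i) - v) < 2 * pi / real n + h \<and>
           poly (cheb k) (2 * v ^ n - 1) \<in> {-1, 1}"
    by blast
  from k(2) obtain y where y: "\<And>i. i < N \<Longrightarrow> norm (poly (critical_poly a N x1) (x1 i) - y i) < 2 * pi / real n + h"
      "\<And>i. i < N \<Longrightarrow> poly (cheb k) (2 * y i ^ n - 1) \<in> {-1, 1}"
    by (elim choice[THEN exE]) blast
  have "norm (poly (critical_poly a N x1) (x1 i) - y i) < \<eta>" if "i < N" for i
    using y(1)[OF that] n(2) h(3) by linarith
  then obtain x where x: "\<And>j. norm (x j - x1 j) \<le> r / 2" "\<And>i. i < N \<Longrightarrow> poly (critical_poly a N x) (x i) = y i"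
    using \<eta>(2)[of y] by blast
  have xr: "norm (x j - x0 j) \<le> r" for j
    using norm_triangle_ineq[of "x j - x1 j" "x1 j - x0 j"] x(1)[of j] x1(2)[of j] by simp
  define q where "q = critical_poly a N x"
  have lc: "coeff q (Suc N) = a / of_nat (Suc N)" "a / of_nat (Suc N) \<noteq> 0"
    using a by (simp_all add: q_def coeff_critical_poly_Suc del: of_nat_Suc)
  have deg: "degree q = Suc N"
    using degree_critical_poly_le[of a N x] le_degree[of q "Suc N"] lc unfolding q_def by (intro antisym) auto
  show thesis
  proof (rule that[of n k q])
    show "poly (cheb k) (2 * poly q c ^ n - 1) \<in> {-1, 1}" if c: "poly (pderiv q) c = 0" for c
    proof -
      obtain i where "i < N" "c = x i"
        using c a by (auto simp: q_def pderiv_critical_poly poly_root_poly)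
      then show ?thesis using x(2) y(2) unfolding q_def by simp
    qed
    show "z \<in> U" if "norm (poly q z) \<le> 1" for z
      using good[OF xr] that unfolding q_def by blast
    show "\<exists>z. norm (z - w) < e \<and> poly q z ^ n \<in> of_real ` {0..1}" if w: "w \<in> F" for w
    proof -
      have w1: "norm (poly q w) < 1" using good[OF xr] w unfolding q_def by blast
      then obtain \<alpha> where \<alpha>: "cis \<alpha> ^ n = 1"
          "norm (poly q w - of_real (norm (poly q w)) * cis \<alpha>) \<le> 2 * pi / real n"
        using star_dense[of "poly q w" n] n(1) by auto
      have "norm (poly q w - of_real (norm (poly q w)) * cis \<alpha>) < norm (lead_coeff q) * e ^ Suc N"
        using \<alpha>(2) n(2) h(4) unfolding deg lc(1) \<eta>2_def by linarith
      then obtain z where z: "poly q z = of_real (norm (poly q w)) * cis \<alpha>" "norm (z - w) < e"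
        using poly_root_near[OF deg _ \<open>e > 0\<close>] by blast
      have "poly q z ^ n = of_real (norm (poly q w) ^ n)"
        unfolding z(1) power_mult_distrib \<alpha>(1) by simp
      moreover have "norm (poly q w) ^ n \<in> {0..1}" using w1 power_le_one[of "norm (poly q w)" n] by simp
      ultimately show ?thesis using z(2) by blast
    qed
  qed (use n k deg in auto)
qed

theorem theorem1p1:
  fixes K :: "complex set" and \<epsilon> :: real
  assumes "K \<noteq> {}" "compact K" "connected K" "\<epsilon> > 0"
  shows "\<exists>p :: complex poly. critical_values p = {-1, 1} \<and>
           hausdorff_dist (poly p -` (complex_of_real ` {-1..1})) K < \<epsilon>"
proof -
  \<comment> \<open>Each inclusion costs at most 2 * e: in the second, one \<open>e\<close> goes to
    the net and one to the distance from a net point to the preimage. The infimum gives only <= 2 *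
    e, and \<epsilon> / 4 leaves room for the strict inequality.\<close>
  define e where "e = \<epsilon> / 4"
  have e: "e > 0" using assms by (simp add: e_def)
  define U where "U = (\<Union>x\<in>K. ball x e)"
  obtain F T where FT: "finite F" "F \<subseteq> T" "K \<subseteq> (\<Union>x\<in>F. ball x e)" "T \<subseteq> U"
      "compact T" "path_connected T" "connected (- T)" "\<exists>a\<in>T. \<exists>b\<in>T. a \<noteq> b"
    using continuum_approximation[OF assms(1-3) e] unfolding U_def by metis
  have "open U" by (auto simp: U_def)
  have "bounded U"
  proof -
    obtain R where R: "\<And>x. x \<in> K \<Longrightarrow> norm x \<le> R"
      using compact_imp_bounded[OF assms(2)] by (auto simp: bounded_iff)
    have "norm z \<le> R + e" if zU: "z \<in> U" for z
    proof -
      obtain x where "x \<in> K" "dist x z < e" using zU by (auto simp: U_def)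
      then show ?thesis using R[of x] norm_triangle_sub[of z x] by (simp add: dist_norm norm_minus_commute)
    qed
    then show ?thesis by (rule boundedI)
  qed
  obtain p where p: "\<And>z. norm (poly p z) \<le> 1 \<Longrightarrow> z \<in> U" "\<And>z. z \<in> T \<Longrightarrow> norm (poly p z) < 1"
      "\<And>c. poly (pderiv p) c = 0 \<Longrightarrow> norm (poly p c) < 1"
    using lemniscate_polynomial[OF FT(5-7) _ _ _ \<open>open U\<close> FT(4)] FT(8) by metis
  \<comment> \<open>A constant \<open>p\<close> would make every point critical, so norm (poly p z)
    < 1 everywhere and \<open>U\<close> the whole plane, although \<open>U\<close> is
    bounded.\<close>
  have "degree p > 0"
  proof (rule ccontr)
    assume "\<not> degree p > 0"
    then obtain c where "p = [:c:]" by (metis degree_eq_zeroE gr0I)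
    then have "U = UNIV" using p(1,3) by (auto simp: pderiv_pCons less_imp_le)
    then show False using \<open>bounded U\<close> not_bounded_UNIV by metis
  qed
  have pF: "norm (poly p w) < 1" if "w \<in> F" for w using p(2) FT(2) that by blast
  obtain n k q where q: "n > 0" "k \<ge> 2" "degree q > 0"
      "\<And>c. poly (pderiv q) c = 0 \<Longrightarrow> poly (cheb k) (2 * poly q c ^ n - 1) \<in> {-1, 1}"
      "\<And>z. norm (poly q z) \<le> 1 \<Longrightarrow> z \<in> U"
      "\<And>w. w \<in> F \<Longrightarrow> \<exists>z. norm (z - w) < e \<and> poly q z ^ n \<in> of_real ` {0..1}"
    by (rule star_tree_exists[OF \<open>degree p > 0\<close> \<open>open U\<close> FT(1) e])
      ((rule p(1) pF p(3), assumption) | rule that)+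
  define P where "P = cheb k \<circ>\<^sub>p ([:-1:] + smult 2 (q ^ n))"
  define A where "A = poly P -` (complex_of_real ` {-1..1})"
  have P: "poly P z = poly (cheb k) (2 * poly q z ^ n - 1)" for z
    by (simp add: P_def poly_pcompose)
  have A: "z \<in> A \<longleftrightarrow> 2 * poly q z ^ n - 1 \<in> of_real ` {-1..1}" for z
    unfolding A_def vimage_eq P cheb_in_interval_iff ..
  have "A \<subseteq> nbhd K (2 * e)"
  proof
    fix z assume "z \<in> A"
    then obtain t where t: "2 * poly q z ^ n - 1 = of_real t" "-1 \<le> t" "t \<le> 1" by (auto simp: A)
    then have "2 * poly q z ^ n = of_real (t + 1)" by (simp add: algebra_simps)
    then have "norm (2 * poly q z ^ n) = norm (complex_of_real (t + 1))" by (rule arg_cong)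
    then have "2 * norm (poly q z) ^ n = \<bar>t + 1\<bar>"
      by (simp only: norm_mult norm_power norm_of_real norm_numeral)
    then have "norm (poly q z) ^ n \<le> 1" using t by simp
    then have "norm (poly q z) \<le> 1" using q(1) by (meson not_le one_less_power)
    then have "z \<in> U" by (rule q(5))
    then obtain x where "x \<in> K" "dist x z < e" by (auto simp: U_def)
    then show "z \<in> nbhd K (2 * e)" using e unfolding nbhd_def by (force simp: dist_commute)
  qed
  moreover have "K \<subseteq> nbhd A (2 * e)"
  proof
    fix x assume "x \<in> K"
    then obtain w where w: "w \<in> F" "dist w x < e" using FT(3) by auto
    obtain z where z: "norm (z - w) < e" "poly q z ^ n \<in> of_real ` {0..1}" using q(6)[OF w(1)] by blast
    then obtain s where s: "poly q z ^ n = of_real s" "0 \<le> s" "s \<le> 1" by auto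
    have "z \<in> A" unfolding A by (rule image_eqI[of _ _ "2 * s - 1"]) (use s in auto)
    moreover have "dist x z < 2 * e"
      using dist_triangle[of x z w] w(2) z(1) by (simp add: dist_commute dist_norm norm_minus_commute)
    ultimately show "x \<in> nbhd A (2 * e)" unfolding nbhd_def by blast
  qed
  ultimately have "hausdorff_dist A K \<le> 2 * e" using e by (intro hausdorff_dist_le) auto
  also have "\<dots> < \<epsilon>" using assms(4) by (simp add: e_def)
  finally have "hausdorff_dist A K < \<epsilon>" .
  moreover have "critical_values P = {-1, 1}"
    unfolding P_def using q(1-4) by (intro critical_values_cheb_comp)
  ultimately show ?thesis unfolding A_def by blast
qed

end
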